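(* Suppose that there exist absolute constants $\gamma_0,\epsilon_0>0$ such that, for every fixed $0<\epsilon<\epsilon_0$, the random graph $G\sim\mathcal{G}(n,p)$ with $p=\frac{1+\epsilon}{n}$ satisfies $$\mathbb{P}\big(L_{\max}(G)\geq\gamma_0\epsilon^2 n\big)\to 1\quad\text{as } n\to\infty.$$ Then for every fixed $0<\epsilon<\epsilon_0$ and every fixed integer $\ell\geq 3$, writing $c=1+\epsilon$, the random graph $G\sim\mathcal{G}(n,p)$ with $p=\frac{c}{n}=\frac{1+\epsilon}{n}$ satisfies $$\mathbb{P}\big(\{k\in\mathbb{Z}:\ \ell\leq k\leq(1-\delta)\gamma_0\epsilon^2 n\}\subset\mathscr{L}(G)\big)\to\theta(c,\ell)\quad\text{as } n\to\infty,\ \text{for every fixed } 0<\delta<1.$$ The same statement holds for $G\sim\mathcal{D}(n,p)$ with $p=\frac{1+\epsilon}{n}$ when replacing $\theta(c,\ell)$ by $\theta'(c,\ell)$.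
   Context: $\mathcal{G}(n,p)$ is the binomial random graph on $n$ vertices, in which each undirected edge appears independently with probability $p$. $\mathcal{D}(n,p)$ is its directed analog: each of the $n(n-1)$ ordered pairs of distinct vertices is a directed edge independently with probability $p$. For a graph (resp. digraph) $G$, $\mathscr{L}(G)$ is the set of lengths of all cycles (resp. directed cycles) in $G$, and $L_{\max}(G)$ is the length of a longest cycle (resp. directed cycle) in $G$. For $c>1$ and integer $\ell\geq 3$, $$\theta(c,\ell):=\prod_{k=\ell}^\infty\big(1-e^{-c^k/(2k)}\big),\qquad \theta'(c,\ell):=\prod_{k=\ell}^\infty\big(1-e^{-c^k/k}\big).$$ *)

theory Defs
  imports "HOL-Probability.Probability" "Graph_Theory.Graph_Theory"
begin

text \<open>
  Random graphs are represented in the style of \<open>Graph_Theory\<close>: an undirected simple graph is a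
  symmetric loop-free digraph (locale \<open>pair_graph\<close>), a simple digraph is a loop-free digraph without
  parallel arcs (locale \<open>pair_digraph\<close>); the vertex set is \<open>{..<n}\<close>. The function \<open>f\<close> below records
  the outcomes of the independent coin flips, one for each unordered (for \<open>gnp\<close>) or ordered
  (for \<open>dnp\<close>) pair of distinct vertices. The constant \<open>bernoulli_pmf\<close> truncates its argument to
  the interval from 0 to 1, so \<open>gnp n p\<close> and \<open>dnp n p\<close> are meaningful only for \<open>p\<close> in that interval.
\<close>

definition gnp :: "nat \<Rightarrow> real \<Rightarrow> nat pair_pre_digraph pmf" where
  "gnp n p =
     map_pmf (\<lambda>f. \<lparr>pverts = {..<n}, parcs = {(u, v). u < n \<and> v < n \<and> u \<noteq> v \<and> f {u, v}}\<rparr>)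
       (Pi_pmf {{u, v} |u v. u < n \<and> v < n \<and> u \<noteq> v} False (\<lambda>_. bernoulli_pmf p))"

definition dnp :: "nat \<Rightarrow> real \<Rightarrow> nat pair_pre_digraph pmf" where
  "dnp n p =
     map_pmf (\<lambda>f. \<lparr>pverts = {..<n}, parcs = {(u, v). u < n \<and> v < n \<and> u \<noteq> v \<and> f (u, v)}\<rparr>)
       (Pi_pmf {(u, v). u < n \<and> v < n \<and> u \<noteq> v} False (\<lambda>_. bernoulli_pmf p))"

lemma pair_graph_gnp: "G \<in> set_pmf (gnp n p) \<Longrightarrow> pair_graph G"
proof -
  assume "G \<in> set_pmf (gnp n p)"
  then obtain f :: "nat set \<Rightarrow> bool" where
    G: "G = \<lparr>pverts = {..<n}, parcs = {(u, v). u < n \<and> v < n \<and> u \<noteq> v \<and> f {u, v}}\<rparr>"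
    by (auto simp: gnp_def)
  have "finite (parcs G)"
    by (rule finite_subset[of _ "{..<n} \<times> {..<n}"]) (auto simp: G)
  moreover have "sym (parcs G)" by (auto simp: G sym_def insert_commute)
  ultimately show ?thesis
    by unfold_locales (auto simp: G symmetric_def)
qed

lemma pair_digraph_dnp: "G \<in> set_pmf (dnp n p) \<Longrightarrow> pair_digraph G"
proof -
  assume "G \<in> set_pmf (dnp n p)"
  then obtain f :: "nat \<times> nat \<Rightarrow> bool" where
    G: "G = \<lparr>pverts = {..<n}, parcs = {(u, v). u < n \<and> v < n \<and> u \<noteq> v \<and> f (u, v)}\<rparr>"
    by (auto simp: dnp_def)
  have "finite (parcs G)"
    by (rule finite_subset[of _ "{..<n} \<times> {..<n}"]) (auto simp: G)
  then show ?thesis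
    by unfold_locales (auto simp: G)
qed

definition dicycle_lengths :: "'a pair_pre_digraph \<Rightarrow> nat set" where
  "dicycle_lengths G = {length p |p. pre_digraph.cycle (with_proj G) p}"

text \<open>
  In a symmetric digraph every edge gives a directed cycle \<open>u, v, u\<close>, which is not a cycle of the
  undirected graph. The directed cycles of length at least 3 are the oriented cycles of the
  undirected graph.
\<close>

definition cycle_lengths :: "'a pair_pre_digraph \<Rightarrow> nat set" where
  "cycle_lengths G = {length p |p. pre_digraph.cycle (with_proj G) p \<and> 3 \<le> length p}"

text \<open>The length of a longest cycle is 0 if there is no cycle.\<close>

definition longest_cycle :: "'a pair_pre_digraph \<Rightarrow> nat" where
  "longest_cycle G = Max (insert 0 (cycle_lengths G))"

definition longest_dicycle :: "'a pair_pre_digraph \<Rightarrow> nat" where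
  "longest_dicycle G = Max (insert 0 (dicycle_lengths G))"

text \<open>The products run over all \<open>k \<ge> \<ell>\<close>; the index below is \<open>j = k - \<ell>\<close>.\<close>

definition theta :: "real \<Rightarrow> nat \<Rightarrow> real" where
  "theta c l = (\<Prod>j. 1 - exp (- (c ^ (l + j) / (2 * real (l + j)))))"

definition theta' :: "real \<Rightarrow> nat \<Rightarrow> real" where
  "theta' c l = (\<Prod>j. 1 - exp (- (c ^ (l + j) / real (l + j))))"

end

theory Submission
  imports Defs "HOL-Real_Asymp.Real_Asymp"
begin

text \<open>
  The limit is decided by the cycles of bounded length. With \<open>p = c / n\<close> the expected number of
  cycles of a fixed length \<open>k\<close> tends to \<open>c ^ k / (s * k)\<close>, where \<open>s\<close> is the number of orientations
  of a cycle that are identified (2 for graphs, 1 for digraphs), and the numbers of cycles of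
  different lengths behave like independent Poisson variables. So all lengths from \<open>l\<close> up to a
  constant \<open>K\<close> occur with probability close to the corresponding partial product of the theta
  product. All lengths from \<open>K\<close> up to the upper end of the range occur with probability close to 1,
  uniformly in \<open>n\<close>, when \<open>K\<close> is large. Letting first \<open>n\<close> and then \<open>K\<close> tend to infinity gives the
  theorem (\<open>prob_all_cycle_lengths_tendsto\<close>).

  \<^emph>\<open>Bounded lengths.\<close> By inclusion and exclusion over the set of missing lengths, only the
  probability that no cycle has its length in a given finite set \<open>S\<close> is needed
  (\<open>prob_cycle_lengths_tendsto\<close>). Adding the possible cycles one at a time and using that edge-disjoint
  cycles are independent, one sees that this probability differs from the product of the
  probabilities that the single cycles are absent by at most the expected number of ordered pairs of
  distinct present cycles that share an edge (\<open>avoid_all_approx\<close>). The union of such a pair has more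
  edges than vertices (\<open>card_cyc_keys_Un\<close>), so this expectation is of order \<open>1 / n\<close>. The product itself
  consists of the factors \<open>(1 - p ^ k) ^ N\<close> for \<open>k\<close> in \<open>S\<close>, where \<open>N\<close> is the number of possible
  cycles of length \<open>k\<close>, and each factor converges to \<open>exp (- c ^ k / (s * k))\<close>.

  \<^emph>\<open>Long cycles.\<close> A graph with parameter \<open>(1 + \<epsilon>) / n\<close> is the union of two independent graphs, one
  with parameter \<open>(1 + \<epsilon>1) / n\<close> for some \<open>\<epsilon>1\<close> slightly smaller than \<open>\<epsilon>\<close> and one whose parameter is
  still of order \<open>1 / n\<close> (\<open>sprinkling\<close>). By hypothesis the first one contains with high probability a
  cycle, hence a path \<open>x 0, x 1, ...\<close>, that is longer than the range of lengths by a positive multiple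
  of \<open>n\<close>. An edge from \<open>x u\<close> to \<open>x v\<close> and an edge from \<open>x j\<close> back to \<open>x i\<close>, where
  \<open>i \<le> u < v \<le> j\<close>, close the two pieces of the path from \<open>x i\<close> to \<open>x u\<close> and from \<open>x v\<close> to \<open>x j\<close> to a
  cycle. The path is traversed in its own direction only, so this works for digraphs too.
  For a prescribed length \<open>k\<close> the difference \<open>d = v - u\<close> determines \<open>j - i = d + k - 2\<close>, and
  different \<open>d\<close> use disjoint sets of edges once \<open>u\<close> is restricted to even and \<open>i\<close> to odd positions. Each of linearly many \<open>d\<close> succeeds independently with probability
  of order \<open>k / n\<close>: some edge of the first kind is present with probability bounded below, and it can
  then be completed in about \<open>k\<close> ways. So the length \<open>k\<close> is missed with probability at most
  \<open>exp (- \<rho> * k)\<close>, and the sum over \<open>k \<ge> K\<close> is small.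
\<close>

section \<open>Independent coin flips\<close>

text \<open>
  All graph events are events about independent coin flips, one for each key in a finite set. Their
  independence is read off from the sets of keys that they look at.
\<close>

definition depends_on :: "(('k \<Rightarrow> bool) \<Rightarrow> bool) \<Rightarrow> 'k set \<Rightarrow> bool" where
  "depends_on X B \<longleftrightarrow> (\<forall>f g. (\<forall>x\<in>B. f x = g x) \<longrightarrow> X f = X g)"

lemma depends_onD: "depends_on X B \<Longrightarrow> (\<And>x. x \<in> B \<Longrightarrow> f x = g x) \<Longrightarrow> X f = X g"
  unfolding depends_on_def by blast

lemma depends_on_mono: "depends_on X B \<Longrightarrow> B \<subseteq> C \<Longrightarrow> depends_on X C"
  unfolding depends_on_def by blast

lemma depends_on_not: "depends_on X B \<Longrightarrow> depends_on (\<lambda>f. \<not> X f) B"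
  unfolding depends_on_def by metis

lemma depends_on_conj: "depends_on X B \<Longrightarrow> depends_on Y C \<Longrightarrow> depends_on (\<lambda>f. X f \<and> Y f) (B \<union> C)"
  unfolding depends_on_def by (metis UnCI)

lemma depends_on_all:
  "(\<And>i. i \<in> I \<Longrightarrow> depends_on (X i) (B i)) \<Longrightarrow> depends_on (\<lambda>f. \<forall>i\<in>I. X i f) (\<Union>i\<in>I. B i)"
  unfolding depends_on_def by (metis UN_I)

lemma depends_on_ex:
  "(\<And>i. i \<in> I \<Longrightarrow> depends_on (X i) (B i)) \<Longrightarrow> depends_on (\<lambda>f. \<exists>i\<in>I. X i f) (\<Union>i\<in>I. B i)"
  unfolding depends_on_def by (metis UN_I)

lemma depends_on_coord: "depends_on (\<lambda>f. f e) {e}"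
  unfolding depends_on_def by simp

lemma depends_on_open: "depends_on (\<lambda>f. \<forall>e\<in>E. f e) E"
  unfolding depends_on_def by simp

text \<open>
  The product measure splits into the flips inside \<open>B\<close> and the flips outside \<open>B\<close>; the first factor
  decides \<open>X\<close> and the second decides \<open>Y\<close>.
\<close>

lemma prob_Pi_pmf_conj:
  fixes p :: "'k \<Rightarrow> bool pmf"
  assumes "finite A" "depends_on X B" "depends_on Y C" "B \<inter> C = {}"
  shows "measure_pmf.prob (Pi_pmf A False p) {f. X f \<and> Y f} =
    measure_pmf.prob (Pi_pmf A False p) {f. X f} * measure_pmf.prob (Pi_pmf A False p) {f. Y f}"
proof -
  define P where "P = Pi_pmf (A \<inter> B) False p"
  define Q where "Q = Pi_pmf (A - B) False p"
  have M: "Pi_pmf A False p = map_pmf (\<lambda>(f, g) x. if x \<in> A \<inter> B then f x else g x) (pair_pmf P Q)"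
  proof -
    have "A \<inter> B \<union> (A - B) = A" by blast
    then show ?thesis
      using Pi_pmf_union[of "A \<inter> B" "A - B" False p] assms(1)
      unfolding P_def Q_def by (metis Diff_disjoint Int_assoc Int_empty_right finite_Diff finite_Int)
  qed
  \<comment> \<open>The marginal probabilities of \<open>X\<close> and \<open>Y\<close> are the cases where the other predicate is constantly true.\<close>
  have fac: "emeasure (measure_pmf (Pi_pmf A False p)) {f. X' f \<and> Y' f} =
      emeasure (measure_pmf P) {f. X' f} * emeasure (measure_pmf Q) {f. Y' f}"
    if X': "depends_on X' B" and Y': "depends_on Y' C" for X' Y'
  proof -
    have "emeasure (measure_pmf (Pi_pmf A False p)) {f. X' f \<and> Y' f} =
        (\<integral>\<^sup>+f. \<integral>\<^sup>+g. indicator {f. X' f \<and> Y' f} (\<lambda>x. if x \<in> A \<inter> B then f x else g x)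
           \<partial>measure_pmf Q \<partial>measure_pmf P)"
      unfolding M by (simp add: nn_integral_pair_pmf' case_prod_unfold indicator_def flip: nn_integral_indicator)
    also have "\<dots> = (\<integral>\<^sup>+f. \<integral>\<^sup>+g. indicator {f. X' f} f * indicator {f. Y' f} g
           \<partial>measure_pmf Q \<partial>measure_pmf P)"
    proof (intro nn_integral_cong_AE, subst AE_measure_pmf_iff, intro ballI,
           intro nn_integral_cong_AE, subst AE_measure_pmf_iff, intro ballI)
      fix f g assume f: "f \<in> set_pmf P" and g: "g \<in> set_pmf Q"
      have f0: "f x = False" if "x \<notin> A \<inter> B" for x
        using f set_Pi_pmf_subset[of "A \<inter> B" False p] that assms(1) unfolding P_def by auto
      have g0: "g x = False" if "x \<notin> A - B" for x
        using g set_Pi_pmf_subset[of "A - B" False p] that assms(1) unfolding Q_def by auto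
      have "X' (\<lambda>x. if x \<in> A \<inter> B then f x else g x) = X' f"
        by (rule depends_onD[OF X']) (use f0 g0 in auto)
      moreover have "Y' (\<lambda>x. if x \<in> A \<inter> B then f x else g x) = Y' g"
        by (rule depends_onD[OF Y']) (use assms(4) in auto)
      ultimately show "indicator {f. X' f \<and> Y' f} (\<lambda>x. if x \<in> A \<inter> B then f x else g x) =
        (indicator {f. X' f} f * indicator {f. Y' f} g :: ennreal)"
        by (auto simp: indicator_def)
    qed
    also have "\<dots> = emeasure (measure_pmf P) {f. X' f} * emeasure (measure_pmf Q) {f. Y' f}"
      by (simp add: nn_integral_cmult nn_integral_multc)
    finally show ?thesis .
  qed
  have X: "emeasure (measure_pmf (Pi_pmf A False p)) {f. X f} = emeasure (measure_pmf P) {f. X f}"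
    using fac[of X "\<lambda>_. True"] assms(2) by (simp add: depends_on_def measure_pmf.emeasure_space_1[simplified])
  have Y: "emeasure (measure_pmf (Pi_pmf A False p)) {f. Y f} = emeasure (measure_pmf Q) {f. Y f}"
    using fac[of "\<lambda>_. True" Y] assms(3) by (simp add: depends_on_def measure_pmf.emeasure_space_1[simplified])
  have "ennreal (measure_pmf.prob (Pi_pmf A False p) {f. X f \<and> Y f}) =
     ennreal (measure_pmf.prob (Pi_pmf A False p) {f. X f} * measure_pmf.prob (Pi_pmf A False p) {f. Y f})"
    using fac[OF assms(2,3)] X Y by (simp add: measure_pmf.emeasure_eq_measure ennreal_mult)
  then show ?thesis by (simp add: )
qed

lemma prob_all_eq:
  assumes "finite A" "E \<subseteq> A"
  shows "measure_pmf.prob (Pi_pmf A False (\<lambda>_. P)) {f. \<forall>e\<in>E. f e = b} = pmf P b ^ card E"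
proof -
  have "{f. \<forall>e\<in>E. f e = b} = Pi A (\<lambda>e. if e \<in> E then {b} else UNIV)"
    using assms(2) by (auto simp: Pi_def split: if_splits)
  then have "measure_pmf.prob (Pi_pmf A False (\<lambda>_. P)) {f. \<forall>e\<in>E. f e = b} =
    (\<Prod>e\<in>A. measure_pmf.prob P (if e \<in> E then {b} else UNIV))"
    using measure_Pi_pmf_Pi[OF assms(1)] by simp
  also have "\<dots> = (\<Prod>e\<in>A. if e \<in> E then pmf P b else 1)"
    by (rule prod.cong) (auto simp: measure_pmf_single measure_pmf.prob_space[simplified])
  also have "\<dots> = pmf P b ^ card E"
    using assms by (simp add: prod.If_cases Int_absorb1)
  finally show ?thesis .
qed

lemma prob_all_open:
  assumes "finite A" "E \<subseteq> A" "0 \<le> q" "q \<le> 1"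
  shows "measure_pmf.prob (Pi_pmf A False (\<lambda>_. bernoulli_pmf q)) {f. \<forall>e\<in>E. f e} = q ^ card E"
  using prob_all_eq[OF assms(1,2), of "bernoulli_pmf q" True] assms(3,4) by simp

lemma prob_all_closed:
  assumes "finite A" "E \<subseteq> A" "0 \<le> q" "q \<le> 1"
  shows "measure_pmf.prob (Pi_pmf A False (\<lambda>_. bernoulli_pmf q)) {f. \<forall>e\<in>E. \<not> f e} = (1 - q) ^ card E"
  using prob_all_eq[OF assms(1,2), of "bernoulli_pmf q" False] assms(3,4) by simp

text \<open>
  Predicates on disjoint sets of keys are independent, so the probabilities of failure multiply.
\<close>

lemma prob_none_le:
  assumes A: "finite A" and "finite I" and "\<And>i. i \<in> I \<Longrightarrow> depends_on (X i) (B i)"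
    and "\<And>i j. i \<in> I \<Longrightarrow> j \<in> I \<Longrightarrow> i \<noteq> j \<Longrightarrow> B i \<inter> B j = {}"
    and "\<And>i. i \<in> I \<Longrightarrow> r \<le> measure_pmf.prob (Pi_pmf A False p) {f. X i f}" and "0 \<le> r"
  shows "measure_pmf.prob (Pi_pmf A False p) {f. \<forall>i\<in>I. \<not> X i f} \<le> (1 - r) ^ card I"
  using assms(2-5)
proof (induction I rule: finite_induct)
  case empty
  show ?case by simp
next
  case (insert i I)
  let ?M = "Pi_pmf A False p"
  have "measure_pmf.prob ?M {f. \<forall>j\<in>insert i I. \<not> X j f} =
      measure_pmf.prob ?M {f. \<not> X i f \<and> (\<forall>j\<in>I. \<not> X j f)}" by simp
  also have "\<dots> = measure_pmf.prob ?M {f. \<not> X i f} * measure_pmf.prob ?M {f. \<forall>j\<in>I. \<not> X j f}"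
    using insert.prems insert.hyps
    by (intro prob_Pi_pmf_conj[OF A, where B = "B i" and C = "\<Union>j\<in>I. B j"] depends_on_not depends_on_all) blast+
  also have "measure_pmf.prob ?M {f. \<not> X i f} = 1 - measure_pmf.prob ?M {f. X i f}"
    using measure_pmf.prob_compl[of "{f. X i f}" ?M] by (simp add: Collect_neg_eq Compl_eq_Diff_UNIV)
  also have "\<dots> * measure_pmf.prob ?M {f. \<forall>j\<in>I. \<not> X j f} \<le> (1 - r) * (1 - r) ^ card I"
  proof (intro mult_mono)
    show "0 \<le> 1 - r"
      using insert.prems(3)[of i] order_trans[OF _ measure_pmf.prob_le_1[of ?M "{f. X i f}"], of r] by simp
  qed (use insert in auto)
  finally show ?case using insert.hyps by simp
qed

text \<open>
  It pays to think of the first \<open>u\<close> whose key \<open>e u\<close> is open: one exists with probability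
  \<open>1 - (1 - q) ^ card U\<close>, and its companion event \<open>W u\<close> lives on other keys and so still has
  probability at least \<open>w\<close>. The induction conditions on one key at a time.
\<close>

lemma prob_two_stage_ge:
  assumes A: "finite A" and "finite U" and "inj_on e U" and "e ` U \<subseteq> A" and "e ` U \<inter> C = {}"
    and "\<And>u. u \<in> U \<Longrightarrow> depends_on (W u) C"
    and "\<And>u. u \<in> U \<Longrightarrow> w \<le> measure_pmf.prob (Pi_pmf A False (\<lambda>_. bernoulli_pmf q)) {f. W u f}"
    and q: "0 \<le> q" "q \<le> 1"
  shows "(1 - (1 - q) ^ card U) * w \<le>
    measure_pmf.prob (Pi_pmf A False (\<lambda>_. bernoulli_pmf q)) {f. \<exists>u\<in>U. f (e u) \<and> W u f}"
  using assms(2-7)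
proof (induction U rule: finite_induct)
  case empty
  show ?case by simp
next
  case (insert u U)
  let ?M = "Pi_pmf A False (\<lambda>_. bernoulli_pmf q)"
  let ?E = "\<lambda>f. \<exists>u\<in>U. f (e u) \<and> W u f"
  have IH: "(1 - (1 - q) ^ card U) * w \<le> measure_pmf.prob ?M {f. ?E f}"
    using insert by auto
  have u: "measure_pmf.prob ?M {f. f (e u)} = q" "measure_pmf.prob ?M {f. \<not> f (e u)} = 1 - q"
    using prob_all_open[OF A _ q, of "{e u}"] prob_all_closed[OF A _ q, of "{e u}"] insert.prems by auto
  have dep: "depends_on ?E (\<Union>v\<in>U. {e v} \<union> C)"
    using insert.prems by (intro depends_on_ex depends_on_conj depends_on_coord) auto
  have disj: "{e u} \<inter> (\<Union>v\<in>U. {e v} \<union> C) = {}"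
    using insert.prems insert.hyps by auto
  have "(1 - (1 - q) ^ card (insert u U)) * w = q * w + (1 - q) * ((1 - (1 - q) ^ card U) * w)"
    using insert.hyps by (simp add: algebra_simps)
  also have "\<dots> \<le> q * measure_pmf.prob ?M {f. W u f} + (1 - q) * measure_pmf.prob ?M {f. ?E f}"
    using q insert.prems IH by (intro add_mono mult_left_mono) auto
  also have "q * measure_pmf.prob ?M {f. W u f} = measure_pmf.prob ?M {f. f (e u) \<and> W u f}"
    using prob_Pi_pmf_conj[OF A depends_on_coord[of "e u"], of "W u" C "\<lambda>_. bernoulli_pmf q"] insert.prems u
    by auto
  also have "(1 - q) * measure_pmf.prob ?M {f. ?E f} = measure_pmf.prob ?M {f. \<not> f (e u) \<and> ?E f}"
    unfolding u(2)[symmetric]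
    by (rule prob_Pi_pmf_conj[OF A depends_on_not[OF depends_on_coord[of "e u"]] dep disj, symmetric])
  also have "measure_pmf.prob ?M {f. f (e u) \<and> W u f} + measure_pmf.prob ?M {f. \<not> f (e u) \<and> ?E f} =
     measure_pmf.prob ?M ({f. f (e u) \<and> W u f} \<union> {f. \<not> f (e u) \<and> ?E f})"
    by (subst measure_pmf.finite_measure_Union) auto
  also have "\<dots> \<le> measure_pmf.prob ?M {f. \<exists>u\<in>insert u U. f (e u) \<and> W u f}"
    by (intro measure_pmf.finite_measure_mono) auto
  finally show ?case .
qed

section \<open>The probability that none of several sparse patterns occurs\<close>

text \<open>
  An elementary substitute for the Chen-Stein method, for the probability that a sum of indicators
  vanishes. Let \<open>N\<close> say that no pattern in \<open>I\<close> is open, and let \<open>C\<close> say the same for the patterns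
  disjoint from a new pattern \<open>E i\<close>. Then \<open>C\<close> is independent of \<open>E i\<close>, and \<open>C\<close> and \<open>N\<close> differ only if
  a pattern that meets \<open>E i\<close> is open. So inserting \<open>i\<close> multiplies the probability by
  \<open>1 - p ^ card (E i)\<close>, up to an error that is at most the sum over the patterns \<open>E j\<close> meeting \<open>E i\<close>.
  The error of either sign is bounded by the same sum, since
  \<open>p ^ card (E i) * p ^ card (E j) \<le> p ^ card (E i \<union> E j)\<close>.
\<close>

lemma avoid_all_approx:
  fixes E :: "'i \<Rightarrow> 'k set"
  assumes A: "finite A" and "finite I" and "\<And>i. i \<in> I \<Longrightarrow> E i \<subseteq> A" and p: "0 \<le> p" "p \<le> 1"
  shows "\<bar>measure_pmf.prob (Pi_pmf A False (\<lambda>_. bernoulli_pmf p)) {f. \<forall>i\<in>I. \<not> (\<forall>e\<in>E i. f e)}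
      - (\<Prod>i\<in>I. 1 - p ^ card (E i))\<bar>
    \<le> (\<Sum>i\<in>I. \<Sum>j | j \<in> I \<and> j \<noteq> i \<and> E i \<inter> E j \<noteq> {}. p ^ card (E i \<union> E j))"
  using assms(2,3)
proof (induction I rule: finite_induct)
  case empty
  show ?case by simp
next
  case (insert i I)
  define M where "M = measure_pmf (Pi_pmf A False (\<lambda>_. bernoulli_pmf p))"
  define pr where "pr = (\<lambda>X. Sigma_Algebra.measure M {f. X f})"
  define op where "op = (\<lambda>j f. \<forall>e\<in>E j. f e)"
  define nb where "nb = {j \<in> I. E i \<inter> E j \<noteq> {}}"
  define N where "N = (\<lambda>f. \<forall>j\<in>I. \<not> op j f)"
  define C where "C = (\<lambda>f. \<forall>j\<in>I - nb. \<not> op j f)"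
  define w where "w = p ^ card (E i)"
  interpret prob_space M unfolding M_def by (rule measure_pmf.prob_space_axioms)
  have [simp]: "sets M = UNIV" unfolding M_def by simp
  have EA: "E i \<subseteq> A" "\<And>j. j \<in> I \<Longrightarrow> E j \<subseteq> A" using insert.prems by auto
  have fE: "finite (E i)" "\<And>j. j \<in> I \<Longrightarrow> finite (E j)" using EA A finite_subset by metis+
  have finnb: "finite nb" unfolding nb_def using insert.hyps by simp
  have pop: "pr (op j) = p ^ card (E j)" if "j \<in> insert i I" for j
    using prob_all_open[OF A _ p, of "E j"] EA that unfolding pr_def op_def M_def by auto
  have pop2: "pr (\<lambda>f. op i f \<and> op j f) = p ^ card (E i \<union> E j)" if "j \<in> I" for j
  proof -
    have "{f. op i f \<and> op j f} = {f. \<forall>e\<in>E i \<union> E j. f e}" unfolding op_def by auto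
    then show ?thesis using prob_all_open[OF A _ p, of "E i \<union> E j"] EA that
      unfolding pr_def M_def by auto
  qed
  have w: "0 \<le> w" "w \<le> 1" unfolding w_def using p by (auto simp: power_le_one)
  have depC: "depends_on C (\<Union>j\<in>I - nb. E j)" unfolding C_def op_def
    by (intro depends_on_all depends_on_not depends_on_open)
  have indep: "pr (\<lambda>f. op i f \<and> C f) = w * pr C"
    using prob_Pi_pmf_conj[OF A depends_on_open[of "E i"] depC, of "\<lambda>_. bernoulli_pmf p"]
      pop[of i] unfolding pr_def M_def op_def w_def nb_def by auto
  have NC: "pr N \<le> pr C" unfolding pr_def N_def C_def by (intro finite_measure_mono) auto
  have CN: "pr C \<le> pr N + (\<Sum>j\<in>nb. p ^ card (E j))"
  proof -
    have "pr C \<le> Sigma_Algebra.measure M ({f. N f} \<union> (\<Union>j\<in>nb. {f. op j f}))"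
      unfolding pr_def N_def C_def by (intro finite_measure_mono) auto
    also have "\<dots> \<le> pr N + Sigma_Algebra.measure M (\<Union>j\<in>nb. {f. op j f})"
      unfolding pr_def by (intro measure_Un_le) auto
    also have "Sigma_Algebra.measure M (\<Union>j\<in>nb. {f. op j f}) \<le> (\<Sum>j\<in>nb. pr (op j))"
      unfolding pr_def by (intro finite_measure_subadditive_finite finnb) auto
    finally show ?thesis using pop by (simp add: nb_def)
  qed
  \<comment> \<open>Upper bound: enlarge \<open>N\<close> to \<open>C\<close>, use independence, and pay for the difference of \<open>C\<close> and \<open>N\<close>.\<close>
  have up: "pr (\<lambda>f. op i f \<and> N f) \<le> w * pr N + (\<Sum>j\<in>nb. p ^ card (E i \<union> E j))"
  proof -
    have "pr (\<lambda>f. op i f \<and> N f) \<le> pr (\<lambda>f. op i f \<and> C f)"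
      unfolding pr_def N_def C_def by (intro finite_measure_mono) auto
    also have "\<dots> \<le> w * (pr N + (\<Sum>j\<in>nb. p ^ card (E j)))"
      unfolding indep using CN w by (intro mult_left_mono) auto
    also have "\<dots> = w * pr N + (\<Sum>j\<in>nb. p ^ (card (E i) + card (E j)))"
      by (simp add: algebra_simps sum_distrib_left power_add w_def)
    also have "\<dots> \<le> w * pr N + (\<Sum>j\<in>nb. p ^ card (E i \<union> E j))"
      using p by (intro add_left_mono sum_mono power_decreasing card_Un_le) auto
    finally show ?thesis .
  qed
  \<comment> \<open>Lower bound: the outcomes with \<open>E i\<close> open and \<open>C\<close> but not \<open>N\<close> have a second open pattern.\<close>
  have lo: "w * pr N - (\<Sum>j\<in>nb. p ^ card (E i \<union> E j)) \<le> pr (\<lambda>f. op i f \<and> N f)"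
  proof -
    have "w * pr N \<le> pr (\<lambda>f. op i f \<and> C f)"
      unfolding indep using NC w by (intro mult_left_mono) auto
    also have "\<dots> \<le> Sigma_Algebra.measure M ({f. op i f \<and> N f} \<union> (\<Union>j\<in>nb. {f. op i f \<and> op j f}))"
      unfolding pr_def N_def C_def by (intro finite_measure_mono) auto
    also have "\<dots> \<le> pr (\<lambda>f. op i f \<and> N f) + Sigma_Algebra.measure M (\<Union>j\<in>nb. {f. op i f \<and> op j f})"
      unfolding pr_def by (intro measure_Un_le) auto
    also have "Sigma_Algebra.measure M (\<Union>j\<in>nb. {f. op i f \<and> op j f}) \<le> (\<Sum>j\<in>nb. pr (\<lambda>f. op i f \<and> op j f))"
      unfolding pr_def by (intro finite_measure_subadditive_finite finnb) auto
    finally show ?thesis using pop2 by (simp add: nb_def)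
  qed
  have split: "pr (\<lambda>f. \<forall>j\<in>insert i I. \<not> op j f) = pr N - pr (\<lambda>f. op i f \<and> N f)"
  proof -
    have "{f. \<forall>j\<in>insert i I. \<not> op j f} = {f. N f} - {f. op i f \<and> N f}" unfolding N_def by auto
    then show ?thesis unfolding pr_def by (simp add: finite_measure_Diff Collect_mono)
  qed
  define R where "R = (\<Prod>j\<in>I. 1 - p ^ card (E j))"
  have IH: "\<bar>pr N - R\<bar> \<le> (\<Sum>i\<in>I. \<Sum>j | j \<in> I \<and> j \<noteq> i \<and> E i \<inter> E j \<noteq> {}. p ^ card (E i \<union> E j))"
    using insert.IH EA unfolding pr_def M_def N_def op_def R_def by auto
  have "\<bar>pr (\<lambda>f. \<forall>j\<in>insert i I. \<not> op j f) - (1 - w) * R\<bar> \<le> \<bar>(1 - w) * (pr N - R)\<bar> + (\<Sum>j\<in>nb. p ^ card (E i \<union> E j))"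
    unfolding split using up lo by (simp add: algebra_simps abs_le_iff) (smt (verit))
  also have "\<bar>(1 - w) * (pr N - R)\<bar> \<le> 1 * \<bar>pr N - R\<bar>"
    unfolding abs_mult using w by (intro mult_right_mono) auto
  also have "1 * \<bar>pr N - R\<bar> + (\<Sum>j\<in>nb. p ^ card (E i \<union> E j)) \<le>
     (\<Sum>l\<in>I. \<Sum>j | j \<in> insert i I \<and> j \<noteq> l \<and> E l \<inter> E j \<noteq> {}. p ^ card (E l \<union> E j)) +
     (\<Sum>j | j \<in> insert i I \<and> j \<noteq> i \<and> E i \<inter> E j \<noteq> {}. p ^ card (E i \<union> E j))"
  proof (intro add_mono)
    have "(\<Sum>i\<in>I. \<Sum>j | j \<in> I \<and> j \<noteq> i \<and> E i \<inter> E j \<noteq> {}. p ^ card (E i \<union> E j)) \<le>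
       (\<Sum>l\<in>I. \<Sum>j | j \<in> insert i I \<and> j \<noteq> l \<and> E l \<inter> E j \<noteq> {}. p ^ card (E l \<union> E j))"
      using p insert.hyps by (intro sum_mono sum_mono2) auto
    then show "1 * \<bar>pr N - R\<bar> \<le> \<dots>" using IH by simp
    show "(\<Sum>j\<in>nb. p ^ card (E i \<union> E j)) \<le> (\<Sum>j | j \<in> insert i I \<and> j \<noteq> i \<and> E i \<inter> E j \<noteq> {}. p ^ card (E i \<union> E j))"
      unfolding nb_def using p insert.hyps by (intro sum_mono2) auto
  qed
  finally show ?case
    using insert.hyps unfolding pr_def op_def M_def R_def w_def by (simp add: add.commute)
qed

section \<open>Sprinkling\<close>

lemma bernoulli_or:
  assumes "0 \<le> p1" "p1 \<le> 1" "0 \<le> q" "q \<le> 1" "1 - p = (1 - p1) * (1 - q)"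
  shows "bernoulli_pmf p = bernoulli_pmf p1 \<bind> (\<lambda>b. bernoulli_pmf q \<bind> (\<lambda>c. return_pmf (b \<or> c)))"
proof -
  have p: "p = 1 - (1 - p1) * (1 - q)" using assms(5) by simp
  have "0 \<le> p" "p \<le> 1" unfolding p using assms by (auto simp: mult_le_one)
  then show ?thesis
    using assms(1-4)
    by (intro pmf_eqI, rename_tac i, case_tac i) (auto simp: pmf_bind p algebra_simps)
qed

text \<open>
  Flipping all coins in two rounds: whenever the first round is good, the second round completes it
  to \<open>U\<close> with conditional probability at least \<open>r\<close>.
\<close>

lemma sprinkling:
  assumes "finite A" "0 \<le> p1" "p1 \<le> 1" "0 \<le> q" "q \<le> 1" "1 - p = (1 - p1) * (1 - q)"
    and r: "\<And>f. Good f \<Longrightarrow>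
      r \<le> measure_pmf.prob (Pi_pmf A False (\<lambda>_. bernoulli_pmf q)) {g. U (\<lambda>x. f x \<or> g x)}"
  shows "measure_pmf.prob (Pi_pmf A False (\<lambda>_. bernoulli_pmf p1)) {f. Good f} * r \<le>
    measure_pmf.prob (Pi_pmf A False (\<lambda>_. bernoulli_pmf p)) {f. U f}"
proof -
  define P where "P = Pi_pmf A False (\<lambda>_. bernoulli_pmf p1)"
  define Q where "Q = Pi_pmf A False (\<lambda>_. bernoulli_pmf q)"
  have "Pi_pmf A False (\<lambda>_. bernoulli_pmf p) =
      P \<bind> (\<lambda>f. Q \<bind> (\<lambda>g. return_pmf (\<lambda>x. if x \<in> A then f x \<or> g x else False)))"
    unfolding bernoulli_or[OF assms(2-6)] P_def Q_def using assms(1)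
    by (simp add: Pi_pmf_bind[where d' = False])
  also have "\<dots> = P \<bind> (\<lambda>f. map_pmf (\<lambda>g x. f x \<or> g x) Q)"
  proof (intro bind_pmf_cong refl, unfold map_pmf_def, intro bind_pmf_cong refl)
    fix f g assume "f \<in> set_pmf P" "g \<in> set_pmf Q"
    then have "\<forall>x. x \<notin> A \<longrightarrow> \<not> f x" "\<forall>x. x \<notin> A \<longrightarrow> \<not> g x"
      using set_Pi_pmf_subset[OF assms(1), of False] unfolding P_def Q_def by auto
    then show "return_pmf (\<lambda>x. if x \<in> A then f x \<or> g x else False) = return_pmf (\<lambda>x. f x \<or> g x)"
      by (auto intro!: arg_cong[where f = return_pmf])
  qed
  finally have M: "Pi_pmf A False (\<lambda>_. bernoulli_pmf p) = P \<bind> (\<lambda>f. map_pmf (\<lambda>g x. f x \<or> g x) Q)" .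
  have "ennreal (measure_pmf.prob P {f. Good f} * r) = (\<integral>\<^sup>+f. ennreal r * indicator {f. Good f} f \<partial>measure_pmf P)"
    by (simp add: nn_integral_cmult measure_pmf.emeasure_eq_measure mult.commute
        ennreal_mult'' measure_nonneg)
  also have "\<dots> \<le> (\<integral>\<^sup>+f. emeasure (measure_pmf (map_pmf (\<lambda>g x. f x \<or> g x) Q)) {f. U f} \<partial>measure_pmf P)"
    using r unfolding Q_def[symmetric]
    by (intro nn_integral_mono) (auto simp: indicator_def measure_pmf.emeasure_eq_measure vimage_def intro!: ennreal_leI)
  also have "\<dots> = emeasure (measure_pmf (Pi_pmf A False (\<lambda>_. bernoulli_pmf p))) {f. U f}"
    unfolding M by (simp add: emeasure_bind_pmf)
  finally show ?thesis
    unfolding P_def by (simp add: measure_pmf.emeasure_eq_measure)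
qed

section \<open>Cyclic lists and their edges\<close>

lemma mod_add_cancel_nat:
  fixes a b x k :: nat
  assumes "(x + a) mod k = (x + b) mod k"
  shows "a mod k = b mod k"
proof (rule linorder_cases)
  assume "a < b"
  then have "k dvd b - a" using assms mod_eq_dvd_iff_nat[of "x + a" "x + b" k] by simp
  then show ?thesis using mod_eq_dvd_iff_nat[of a b k] \<open>a < b\<close> by simp
next
  assume "b < a"
  then have "k dvd a - b" using assms mod_eq_dvd_iff_nat[of "x + b" "x + a" k] by simp
  then show ?thesis using mod_eq_dvd_iff_nat[of b a k] \<open>b < a\<close> by simp
qed simp

lemma Suc_mod_less: "i < k \<Longrightarrow> Suc i mod k < k" for i k :: nat
  by simp

lemma mod_Suc_image: "(\<lambda>i. Suc i mod k) ` {..<k} = {..<k}"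
proof (cases "k = 0")
  case False
  show ?thesis
  proof (intro equalityI subsetI)
    fix j assume j: "j \<in> {..<k}"
    show "j \<in> (\<lambda>i. Suc i mod k) ` {..<k}"
    proof (cases j)
      case 0
      then show ?thesis using False by (intro image_eqI[of _ _ "k - 1"]) auto
    next
      case (Suc i)
      then show ?thesis using j by (intro image_eqI[of _ _ i]) auto
    qed
  qed (use False in auto)
qed simp

text \<open>
  A property that holds somewhere on a cycle and passes to the cyclic successor holds everywhere. It is
  used in the contrapositive: a cycle that meets a set without being contained in it has an edge that
  leaves the set.
\<close>

lemma cyclic_all:
  assumes "P i" "i < k" "\<And>j. j < k \<Longrightarrow> P j \<Longrightarrow> P (Suc j mod k)"
  shows "j < k \<Longrightarrow> P j"
proof -
  have "P ((i + t) mod k)" for t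
  proof (induction t)
    case (Suc t)
    have "(i + t) mod k < k" using assms(2) by simp
    from assms(3)[OF this Suc] show ?case by (simp add: mod_Suc_eq)
  qed (use assms in simp)
  from this[of "k - i + j"] show "j < k \<Longrightarrow> P j" using assms(2) by simp
qed

text \<open>
  Graphs and digraphs are treated together. The coin that decides the arc from \<open>u\<close> to \<open>v\<close> is
  \<open>key u v\<close>; it is \<open>(u, v)\<close> for digraphs, and for graphs it is \<open>{u, v}\<close>, so that both
  orientations share a coin. The number \<open>s\<close> counts the orientations of a cycle with the same set of
  keys, so a cycle of length \<open>k\<close> arises from \<open>s * k\<close> lists of vertices.
\<close>

locale cycle_keys =
  fixes key :: "nat \<Rightarrow> nat \<Rightarrow> 'k" and s :: nat
  assumes key_eq: "key u v = key x y \<longleftrightarrow> u = x \<and> v = y \<or> s = 2 \<and> u = y \<and> v = x"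
    and s_cases: "s = 1 \<or> s = 2"
begin

definition cyc_keys :: "nat list \<Rightarrow> 'k set" where
  "cyc_keys xs = (\<lambda>i. key (xs ! i) (xs ! (Suc i mod length xs))) ` {..<length xs}"

lemma cyc_keys_rotate1: "cyc_keys (rotate1 xs) = cyc_keys xs"
proof -
  let ?k = "length xs"
  have "cyc_keys (rotate1 xs) =
      (\<lambda>i. key (xs ! i) (xs ! (Suc i mod ?k))) ` (\<lambda>i. Suc i mod ?k) ` {..<?k}"
    unfolding cyc_keys_def image_image 
  proof (intro image_cong refl)
    fix i assume i: "i \<in> {..<length xs}"
    then have "Suc i mod ?k < ?k" by (intro Suc_mod_less) simp
    then show "key (rotate1 xs ! i) (rotate1 xs ! (Suc i mod length (rotate1 xs))) =
        key (xs ! (Suc i mod ?k)) (xs ! (Suc (Suc i mod ?k) mod ?k))"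
      using i by (simp add: nth_rotate1 del: mod_Suc_eq)
  qed simp
  then show ?thesis unfolding mod_Suc_image cyc_keys_def .
qed

lemma cyc_keys_rotate: "cyc_keys (rotate r xs) = cyc_keys xs"
  unfolding rotate_def by (induction r) (auto simp: cyc_keys_rotate1)

lemma cyc_keys_rev:
  assumes "s = 2"
  shows "cyc_keys (rev xs) = cyc_keys xs"
proof -
  have key_sym: "key u v = key v u" for u v using key_eq assms by metis
  have sub: "cyc_keys (rev xs) \<subseteq> cyc_keys xs" for xs
  proof
    fix e assume "e \<in> cyc_keys (rev xs)"
    then obtain i where i: "i < length xs"
      and e: "e = key (rev xs ! i) (rev xs ! (Suc i mod length xs))"
      unfolding cyc_keys_def by auto
    show "e \<in> cyc_keys xs"
    proof (cases "Suc i = length xs")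
      case True
      then have "i = length xs - 1" "0 < length xs" by auto
      then have "e = key (xs ! (length xs - 1)) (xs ! 0)"
        using e True by (simp add: rev_nth key_sym)
      then show ?thesis unfolding cyc_keys_def using \<open>0 < length xs\<close>
        by (intro image_eqI[of _ _ "length xs - 1"]) auto
    next
      case False
      then have "Suc (length xs - Suc (Suc i)) = length xs - Suc i" using i by auto
      then show ?thesis unfolding cyc_keys_def using i e False
        by (intro image_eqI[of _ _ "length xs - Suc (Suc i)"]) (auto simp: rev_nth key_sym)
    qed
  qed
  from sub[of xs] sub[of "rev xs"] show ?thesis by auto
qed

lemma inj_on_cyc_key:
  assumes "distinct xs" "3 \<le> length xs"
  shows "inj_on (\<lambda>i. key (xs ! i) (xs ! (Suc i mod length xs))) {..<length xs}"
proof (intro inj_onI)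
  fix i j assume ij: "i \<in> {..<length xs}" "j \<in> {..<length xs}"
    and eq: "key (xs ! i) (xs ! (Suc i mod length xs)) = key (xs ! j) (xs ! (Suc j mod length xs))"
  have lt: "Suc i mod length xs < length xs" "Suc j mod length xs < length xs"
    using ij by (auto intro: Suc_mod_less)
  from eq consider "xs ! i = xs ! j" | "xs ! i = xs ! (Suc j mod length xs)" "xs ! (Suc i mod length xs) = xs ! j"
    unfolding key_eq by blast
  then show "i = j"
  proof cases
    case 1
    then show ?thesis using ij assms(1) by (simp add: nth_eq_iff_index_eq)
  next
    case 2
    then have "i = Suc j mod length xs" "j = Suc i mod length xs"
      using ij lt assms(1) by (auto simp: nth_eq_iff_index_eq)
    moreover have "Suc j mod length xs = (if Suc j = length xs then 0 else Suc j)"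
      "Suc i mod length xs = (if Suc i = length xs then 0 else Suc i)" using ij by auto
    ultimately have "Suc j = length xs \<and> i = 0 \<or> i = Suc j"
      "Suc i = length xs \<and> j = 0 \<or> j = Suc i" by metis+
    then show ?thesis using assms(2) by linarith
  qed
qed

lemma card_cyc_keys: "distinct xs \<Longrightarrow> 3 \<le> length xs \<Longrightarrow> card (cyc_keys xs) = length xs"
  unfolding cyc_keys_def by (simp add: card_image inj_on_cyc_key)

lemma key_in_cyc_keysD:
  assumes "key u v \<in> cyc_keys xs"
  obtains j where "j < length xs"
    "u = xs ! j \<and> v = xs ! (Suc j mod length xs) \<or> s = 2 \<and> u = xs ! (Suc j mod length xs) \<and> v = xs ! j"
  using assms unfolding cyc_keys_def by (auto simp: key_eq)

lemma key_in_cyc_keys_set: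
  assumes "key u v \<in> cyc_keys xs"
  shows "u \<in> set xs" "v \<in> set xs"
  using assms by (auto elim!: key_in_cyc_keysD intro!: nth_mem Suc_mod_less)

text \<open>
  One cycle contained in another must run around it. After a reversal, if necessary, the first step
  of \<open>ys\<close> goes forward in \<open>zs\<close>, where \<open>zs\<close> is \<open>xs\<close> or its reversal. Each later step
  has to go on forward, because the only other neighbour in \<open>zs\<close> is the vertex that \<open>ys\<close> just came from.
  When \<open>ys\<close> closes up it has therefore gone once around \<open>zs\<close>.
\<close>

lemma cyc_keys_subset_imp_rotate:
  assumes "distinct xs" "distinct ys" "3 \<le> length xs" "3 \<le> length ys" "cyc_keys ys \<subseteq> cyc_keys xs"
  shows "\<exists>r. ys = rotate r xs \<or> s = 2 \<and> ys = rotate r (rev xs)"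
proof -
  let ?k = "length xs" and ?m = "length ys"
  have follow: "ys = rotate a zs"
    if zs: "cyc_keys zs = cyc_keys xs" "distinct zs" "length zs = ?k" and a: "a < ?k"
      and y0: "ys ! 0 = zs ! a" and y1: "ys ! 1 = zs ! (Suc a mod ?k)" for zs a
  proof -
    have kk: "key (ys ! i) (ys ! (Suc i mod ?m)) \<in> cyc_keys zs" if "i < ?m" for i
      using assms(5) zs(1) that unfolding cyc_keys_def[of ys] by auto
    have idx: "zs ! i = zs ! j \<longleftrightarrow> i = j" if "i < ?k" "j < ?k" for i j
      using zs that by (simp add: nth_eq_iff_index_eq)
    have step: "t < ?m \<Longrightarrow> ys ! t = zs ! ((a + t) mod ?k)" for t
    proof (induction t rule: less_induct)
      case (less t)
      consider "t = 0" | "t = 1" | u where "t = Suc (Suc u)"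
        by (metis One_nat_def not0_implies_Suc)
      then show ?case
      proof cases
        case 3
        have yu: "ys ! u = zs ! ((a + u) mod ?k)" and yt: "ys ! Suc u = zs ! ((a + Suc u) mod ?k)"
          using less 3 by auto
        have "key (ys ! Suc u) (ys ! t) \<in> cyc_keys zs"
          using kk[of "Suc u"] less.prems 3 by simp
        then obtain j where j: "j < length zs"
          and d: "ys ! Suc u = zs ! j \<and> ys ! t = zs ! (Suc j mod length zs) \<or>
            s = 2 \<and> ys ! Suc u = zs ! (Suc j mod length zs) \<and> ys ! t = zs ! j"
          by (rule key_in_cyc_keysD)
        from d show ?thesis
        proof (elim disjE conjE)
          assume "ys ! Suc u = zs ! j" and n: "ys ! t = zs ! (Suc j mod length zs)"
          then have "zs ! j = zs ! ((a + Suc u) mod ?k)" using yt by simp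
          moreover have "(a + Suc u) mod ?k < ?k" using a by (intro mod_less_divisor) auto
          ultimately have "j = (a + Suc u) mod ?k" using idx j zs by simp
          then show ?thesis using n zs 3 by (simp add: mod_Suc_eq)
        next
          assume "ys ! Suc u = zs ! (Suc j mod length zs)" and n: "ys ! t = zs ! j"
          then have "zs ! (Suc j mod ?k) = zs ! ((a + Suc u) mod ?k)" using yt zs by simp
          moreover have "(a + Suc u) mod ?k < ?k" "Suc j mod ?k < ?k" using a by (auto intro: mod_less_divisor)
          ultimately have "Suc j mod ?k = (a + Suc u) mod ?k" using idx by blast
          then have "Suc j mod ?k = Suc (a + u) mod ?k" by simp
          then have "j mod ?k = (a + u) mod ?k"
            using mod_add_cancel_nat[of 1 j ?k "a + u"] by simp
          then have "ys ! t = ys ! u" using n yu j zs by simp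
          then show ?thesis using assms(2) less.prems 3 by (simp add: nth_eq_iff_index_eq)
        qed
      qed (use y0 y1 a in auto)
    qed
    have "set ys \<subseteq> set zs"
    proof
      fix y assume "y \<in> set ys"
      then obtain t where "t < ?m" "y = ys ! t" by (auto simp: in_set_conv_nth)
      moreover have "(a + t) mod ?k < ?k" using a by (intro mod_less_divisor) auto
      ultimately show "y \<in> set zs" using step zs by auto
    qed
    then have le: "?m \<le> ?k"
      using card_mono[of "set zs" "set ys"] assms(2) zs by (simp add: distinct_card)
    have "Suc (?m - 1) = ?m" using assms(4) by linarith
    then have "Suc (?m - 1) mod ?m = 0" "?m - 1 < ?m" by simp_all
    then have "key (ys ! (?m - 1)) (ys ! 0) \<in> cyc_keys zs"
      using kk[of "?m - 1"] by simp
    then obtain j where j: "j < length zs"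
      and d: "ys ! (?m - 1) = zs ! j \<and> ys ! 0 = zs ! (Suc j mod length zs) \<or>
         s = 2 \<and> ys ! (?m - 1) = zs ! (Suc j mod length zs) \<and> ys ! 0 = zs ! j"
      by (rule key_in_cyc_keysD)
    have yl: "ys ! (?m - 1) = zs ! ((a + (?m - 1)) mod ?k)" using step assms(4) by simp
    \<comment> \<open>The closing edge also goes forward: in the backward case \<open>length xs\<close> would divide
      \<open>length ys - 2\<close>, which is positive and smaller than \<open>length xs\<close>.\<close>
    have "?m = ?k"
      using d
    proof (elim disjE conjE)
      assume "ys ! (?m - 1) = zs ! j" "ys ! 0 = zs ! (Suc j mod length zs)"
      then have "zs ! j = zs ! ((a + (?m - 1)) mod ?k)" "zs ! a = zs ! (Suc j mod ?k)"
        using yl y0 zs by auto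
      moreover have "(a + (?m - 1)) mod ?k < ?k" "Suc j mod ?k < ?k" using a by (auto intro: mod_less_divisor)
      ultimately have "(a + (?m - 1)) mod ?k = j" and aj: "Suc j mod ?k = a"
        using idx j zs a by metis+
      then have "Suc (a + (?m - 1)) mod ?k = Suc j mod ?k"
        using mod_Suc_eq[of "a + (?m - 1)" ?k] by simp
      moreover have "Suc (a + (?m - 1)) = a + ?m" using assms(4) by linarith
      ultimately have "(a + 0) mod ?k = (a + ?m) mod ?k" using aj a by (metis add.right_neutral mod_less)
      then have "0 mod ?k = ?m mod ?k"
        by (rule mod_add_cancel_nat)
      then have "?k dvd ?m" by (simp add: mod_eq_0_iff_dvd)
      then have "?k \<le> ?m" using assms(4) by (intro dvd_imp_le) auto
      then show ?thesis using le by simp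
    next
      assume "ys ! (?m - 1) = zs ! (Suc j mod length zs)" "ys ! 0 = zs ! j"
      then have "zs ! (Suc j mod ?k) = zs ! ((a + (?m - 1)) mod ?k)" "zs ! a = zs ! j"
        using yl y0 zs by auto
      moreover have "(a + (?m - 1)) mod ?k < ?k" "Suc j mod ?k < ?k" using a by (auto intro: mod_less_divisor)
      ultimately have "Suc j mod ?k = (a + (?m - 1)) mod ?k" "a = j"
        using idx j zs a by metis+
      then have "(a + 1) mod ?k = (a + (?m - 1)) mod ?k" by simp
      then have "1 mod ?k = (?m - 1) mod ?k" by (rule mod_add_cancel_nat)
      then have False using le assms(3,4) by auto
      then show ?thesis ..
    qed
    then show ?thesis
      using step zs by (intro nth_equalityI) (auto simp: nth_rotate)
  qed
  have "key (ys ! 0) (ys ! 1) \<in> cyc_keys xs"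
    using assms(4,5) unfolding cyc_keys_def[of ys]
    by (metis (no_types, lifting) One_nat_def Suc_1 image_subset_iff lessThan_iff less_le_trans
        mod_less numeral_3_eq_3 zero_less_Suc Suc_less_eq)
  then obtain j where j: "j < ?k" and d: "ys ! 0 = xs ! j \<and> ys ! 1 = xs ! (Suc j mod ?k) \<or>
      s = 2 \<and> ys ! 0 = xs ! (Suc j mod ?k) \<and> ys ! 1 = xs ! j"
    by (rule key_in_cyc_keysD)
  from d show ?thesis
  proof (elim disjE conjE)
    assume "ys ! 0 = xs ! j" "ys ! 1 = xs ! (Suc j mod ?k)"
    then show ?thesis using follow[of xs j] assms(1) j by auto
  next
    assume s2: "s = 2" and y: "ys ! 0 = xs ! (Suc j mod ?k)" "ys ! 1 = xs ! j"
    let ?a = "?k - 1 - Suc j mod ?k"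
    have "?a < ?k" using assms(3) by auto
    moreover have "rev xs ! ?a = xs ! (Suc j mod ?k)"
    proof -
      have "Suc j mod ?k < ?k" using j by (rule Suc_mod_less)
      then have "?k - Suc ?a = Suc j mod ?k" by linarith
      then show ?thesis using \<open>?a < ?k\<close> by (simp only: rev_nth)
    qed
    moreover have "rev xs ! (Suc ?a mod ?k) = xs ! j"
    proof (cases "Suc j = ?k")
      case True
      then have "?k - 1 = j" "Suc ?a = ?k" using assms(3) by auto
      then have "Suc ?a mod ?k = 0" by simp
      moreover have "rev xs ! 0 = xs ! j"
        using assms(3) \<open>?k - 1 = j\<close> rev_nth[of 0 xs] by (cases xs) auto
      ultimately show ?thesis by (simp only:)
    next
      case False
      then have "Suc j < ?k" using j by simp
      then show ?thesis by (auto simp: rev_nth Suc_diff_Suc)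
    qed
    ultimately show ?thesis
      using follow[of "rev xs" ?a] assms(1) y s2 cyc_keys_rev[OF s2] by auto
  qed
qed

text \<open>
  One representative of each orbit of lists under rotation, and for graphs also under reversal.
\<close>

definition canonical :: "nat list \<Rightarrow> bool" where
  "canonical xs \<longleftrightarrow> xs ! 0 = Min (set xs) \<and> (s = 2 \<longrightarrow> xs ! 1 < last xs)"

definition vertex_lists :: "nat \<Rightarrow> nat \<Rightarrow> nat list set" where
  "vertex_lists n k = {xs. length xs = k \<and> distinct xs \<and> set xs \<subseteq> {..<n}}"

definition cycles :: "nat \<Rightarrow> nat \<Rightarrow> nat list set" where
  "cycles n k = {xs \<in> vertex_lists n k. canonical xs}"

definition has_cycle :: "nat \<Rightarrow> nat \<Rightarrow> ('k \<Rightarrow> bool) \<Rightarrow> bool" where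
  "has_cycle n k f \<longleftrightarrow> (\<exists>xs\<in>vertex_lists n k. \<forall>e\<in>cyc_keys xs. f e)"

text \<open>
  The reversal that keeps the first vertex.
\<close>

definition flip :: "nat list \<Rightarrow> nat list" where
  "flip xs = hd xs # rev (tl xs)"

lemma flip_eq_rotate: "xs \<noteq> [] \<Longrightarrow> flip xs = rotate (length xs - 1) (rev xs)"
  unfolding flip_def using rotate_append[of "rev (tl xs)" "[hd xs]"]
  by (cases xs) auto

lemma cyc_keys_flip: "s = 2 \<Longrightarrow> xs \<noteq> [] \<Longrightarrow> cyc_keys (flip xs) = cyc_keys xs"
  by (simp add: flip_eq_rotate cyc_keys_rotate cyc_keys_rev)

lemma flip_vertex_lists: "xs \<in> vertex_lists n k \<Longrightarrow> xs \<noteq> [] \<Longrightarrow> flip xs \<in> vertex_lists n k"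
  by (cases xs) (auto simp: flip_def vertex_lists_def)

lemma flip_flip: "xs \<noteq> [] \<Longrightarrow> flip (flip xs) = xs"
  by (simp add: flip_def)

lemma flip_ends:
  assumes "2 \<le> length xs"
  shows "flip xs ! 0 = xs ! 0" "set (flip xs) = set xs" "flip xs ! 1 = last xs" "last (flip xs) = xs ! 1"
  using assms
  by (cases xs; cases "tl xs"; auto simp: flip_def nth_append rev_nth last_conv_nth; fail)+

lemma finite_vertex_lists: "finite (vertex_lists n k)"
  by (rule finite_subset[OF _ finite_lists_length_eq[of "{..<n}" k]]) (auto simp: vertex_lists_def)

lemma finite_cycles: "finite (cycles n k)"
  unfolding cycles_def using finite_vertex_lists by simp

lemma vertex_lists_rotate: "xs \<in> vertex_lists n k \<Longrightarrow> rotate r xs \<in> vertex_lists n k"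
  by (auto simp: vertex_lists_def)

lemma ex_min_nth:
  assumes "xs \<in> vertex_lists n k" "0 < k"
  shows "\<exists>r<k. xs ! r = Min (set xs)"
proof -
  have "Min (set xs) \<in> set xs" using assms by (intro Min_in) (auto simp: vertex_lists_def)
  then show ?thesis using assms by (auto simp: in_set_conv_nth vertex_lists_def)
qed

lemma last_neq_second:
  assumes "xs \<in> vertex_lists n k" "3 \<le> k"
  shows "last xs \<noteq> xs ! 1"
proof -
  have "xs \<noteq> []" using assms by (auto simp: vertex_lists_def)
  then have "last xs = xs ! (k - 1)" using assms by (auto simp: vertex_lists_def last_conv_nth)
  then show ?thesis using assms by (auto simp: vertex_lists_def nth_eq_iff_index_eq)
qed

lemma has_cycle_iff_cycles:
  assumes "3 \<le> k"
  shows "has_cycle n k f \<longleftrightarrow> (\<exists>xs\<in>cycles n k. \<forall>e\<in>cyc_keys xs. f e)"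
proof
  assume "has_cycle n k f"
  then obtain xs where xs: "xs \<in> vertex_lists n k" and f: "\<forall>e\<in>cyc_keys xs. f e"
    unfolding has_cycle_def by auto
  obtain r where r: "r < k" "xs ! r = Min (set xs)" using ex_min_nth[OF xs] assms by auto
  define ys where "ys = rotate r xs"
  have len: "length xs = k" using xs by (simp add: vertex_lists_def)
  have ys: "ys \<in> vertex_lists n k" "cyc_keys ys = cyc_keys xs" "length ys = k"
    unfolding ys_def using xs len by (auto simp: vertex_lists_rotate cyc_keys_rotate)
  have "0 < length xs" using len assms by simp
  then have min: "ys ! 0 = Min (set ys)"
    unfolding ys_def using r len nth_rotate[of 0 xs r] by simp
  show "\<exists>xs\<in>cycles n k. \<forall>e\<in>cyc_keys xs. f e"
  proof (cases "s = 2 \<longrightarrow> ys ! 1 < last ys")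
    case True
    then have "ys \<in> cycles n k" unfolding cycles_def canonical_def using ys min by simp
    then show ?thesis using f ys by auto
  next
    case False
    have "ys \<noteq> []" using ys assms by auto
    moreover have "flip ys \<in> cycles n k"
      unfolding cycles_def canonical_def
      using flip_vertex_lists[OF ys(1)] flip_ends[of ys] ys assms min False last_neq_second[OF ys(1) assms]
        \<open>ys \<noteq> []\<close>
      by auto
    moreover have "cyc_keys (flip ys) = cyc_keys xs"
      using False ys \<open>ys \<noteq> []\<close> cyc_keys_flip by simp
    ultimately show ?thesis using f by metis
  qed
next
  assume "\<exists>xs\<in>cycles n k. \<forall>e\<in>cyc_keys xs. f e"
  then show "has_cycle n k f" unfolding has_cycle_def cycles_def by auto
qed

lemma canonical_unique:
  assumes xs: "xs \<in> cycles n k" and ys: "ys \<in> cycles n m" and "3 \<le> k" "3 \<le> m"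
    and sub: "cyc_keys ys \<subseteq> cyc_keys xs"
  shows "ys = xs"
proof -
  have X: "distinct xs" "length xs = k" "xs ! 0 = Min (set xs)" "s = 2 \<longrightarrow> xs ! 1 < last xs"
    using xs by (auto simp: cycles_def vertex_lists_def canonical_def)
  have Y: "distinct ys" "length ys = m" "ys ! 0 = Min (set ys)" "s = 2 \<longrightarrow> ys ! 1 < last ys"
    using ys by (auto simp: cycles_def vertex_lists_def canonical_def)
  have same: "rotate r zs = zs" if "distinct zs" "zs ! 0 = rotate r zs ! 0" "zs \<noteq> []" for r and zs :: "nat list"
  proof -
    have "0 < length zs" using that by simp
    then have "zs ! 0 = zs ! (r mod length zs)" using that(2) nth_rotate[of 0 zs r] by simp
    moreover have "r mod length zs < length zs" using \<open>0 < length zs\<close> by simp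
    ultimately have "r mod length zs = 0"
      using that(1) \<open>0 < length zs\<close> nth_eq_iff_index_eq by metis
    then show ?thesis by (metis rotate_conv_mod rotate0 id_apply)
  qed
  obtain r where "ys = rotate r xs \<or> s = 2 \<and> ys = rotate r (rev xs)"
    using cyc_keys_subset_imp_rotate[OF X(1) Y(1) _ _ sub] X Y assms by auto
  then show ?thesis
  proof (elim disjE conjE)
    assume y: "ys = rotate r xs"
    then show ?thesis using same[of xs r] X Y assms(3) by fastforce
  next
    assume s2: "s = 2" and y: "ys = rotate r (rev xs)"
    have ne: "xs \<noteq> []" using X assms by auto
    have fl: "distinct (flip xs)" "flip xs \<noteq> []" "length xs \<ge> 2"
      using flip_vertex_lists[of xs n k] xs ne X assms(3) by (auto simp: cycles_def vertex_lists_def flip_def)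
    have "rev xs = rotate 1 (flip xs)"
      using ne by (cases xs) (auto simp: flip_def)
    then have y': "ys = rotate (r + 1) (flip xs)" 
      using y rotate_rotate[of r 1 "flip xs"] by (simp only:)
    then have "ys = flip xs"
      using same[of "flip xs" "r + 1"] fl flip_ends[of xs] X Y by fastforce
    then show ?thesis using flip_ends[of xs] X Y s2 fl by auto
  qed
qed

text \<open>
  Follow \<open>ys\<close> around. Each vertex outside \<open>xs\<close> is followed by a key that is not a key of \<open>xs\<close>, and
  these keys are distinct; this gives as many new keys as new vertices. One more new key
  starts in a vertex of \<open>xs\<close>: it is the place where \<open>ys\<close> leaves \<open>xs\<close>, or, if \<open>ys\<close> never leaves the
  vertices of \<open>xs\<close>, any key that is not one of \<open>xs\<close>, which exists by \<open>canonical_unique\<close>.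
\<close>

lemma card_cyc_keys_Un:
  assumes xs: "xs \<in> cycles n k" and ys: "ys \<in> cycles n m" and km: "3 \<le> k" "3 \<le> m"
    and ne: "xs \<noteq> ys" and meet: "cyc_keys xs \<inter> cyc_keys ys \<noteq> {}"
  shows "card (set (xs @ ys)) + 1 \<le> card (cyc_keys xs \<union> cyc_keys ys)"
proof -
  have X: "distinct xs" "length xs = k" and Y: "distinct ys" "length ys = m"
    using xs ys by (auto simp: cycles_def vertex_lists_def)
  define h where "h = (\<lambda>i. key (ys ! i) (ys ! (Suc i mod m)))"
  define J where "J = {i. i < m \<and> ys ! i \<notin> set xs}"
  have fin: "finite (cyc_keys zs)" for zs unfolding cyc_keys_def by simp
  have hys: "cyc_keys ys = h ` {..<m}" unfolding cyc_keys_def h_def Y by simp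
  have inj: "inj_on h {..<m}" unfolding h_def using inj_on_cyc_key[OF Y(1)] Y km by simp
  have hJ: "h i \<in> cyc_keys ys - cyc_keys xs" if "i \<in> J" for i
    using that key_in_cyc_keys_set(1)[of "ys ! i" "ys ! (Suc i mod m)" xs] unfolding J_def hys h_def by auto
  have "\<exists>i<m. i \<notin> J \<and> h i \<notin> cyc_keys xs"
  proof (cases "J = {}")
    case True
    have "\<not> cyc_keys ys \<subseteq> cyc_keys xs" using canonical_unique[OF xs ys km] ne by auto
    then show ?thesis using True unfolding hys by auto
  next
    case False
    then obtain j where j: "j < m" "ys ! j \<notin> set xs" unfolding J_def by auto
    obtain i where i: "i < m" "h i \<in> cyc_keys xs" using meet unfolding hys by auto
    then have "ys ! i \<in> set xs" using key_in_cyc_keys_set(1) unfolding h_def by auto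
    then obtain l where l: "l < m" "ys ! l \<in> set xs" "ys ! (Suc l mod m) \<notin> set xs"
      using cyclic_all[of "\<lambda>i. ys ! i \<in> set xs" i m j] i j by auto
    then have "h l \<notin> cyc_keys xs" using key_in_cyc_keys_set(2) unfolding h_def by auto
    then show ?thesis using l unfolding J_def by auto
  qed
  then obtain i0 where i0: "i0 < m" "i0 \<notin> J" "h i0 \<notin> cyc_keys xs" by auto
  have "card J + 1 = card (h ` insert i0 J)"
  proof -
    have "insert i0 J \<subseteq> {..<m}" using i0 unfolding J_def by auto
    then have "card (h ` insert i0 J) = card (insert i0 J)"
      by (intro card_image inj_on_subset[OF inj])
    then show ?thesis using i0 by (simp add: J_def)
  qed
  also have "\<dots> \<le> card (cyc_keys ys - cyc_keys xs)"
    using hJ i0 by (intro card_mono) (auto simp: fin hys)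
  finally have *: "card J + 1 \<le> card (cyc_keys ys - cyc_keys xs)" .
  have "set ys - set xs = (\<lambda>i. ys ! i) ` J"
    unfolding J_def using Y by (auto simp: in_set_conv_nth)
  then have "card (set ys - set xs) \<le> card J"
    using card_image_le[of J "\<lambda>i. ys ! i"] by (simp add: J_def)
  moreover have "card (set (xs @ ys)) = card (set xs) + card (set ys - set xs)"
    by (subst card_Un_disjoint[symmetric]) (auto intro: arg_cong[where f = card])
  moreover have "card (cyc_keys xs \<union> cyc_keys ys) = card (cyc_keys xs) + card (cyc_keys ys - cyc_keys xs)"
    using fin by (subst card_Un_disjoint[symmetric]) (auto intro: arg_cong[where f = card])
  moreover have "card (cyc_keys xs) = card (set xs)"
    using card_cyc_keys X km by (simp add: distinct_card)
  ultimately show ?thesis using * by simp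
qed

text \<open>
  Every list of \<open>k\<close> distinct vertices has its minimum at exactly one position, and rotation moves this
  position to the front. For graphs, \<open>flip\<close> then pairs the canonical lists that start with the minimum
  with the other ones.
\<close>

lemma card_cycles:
  assumes k: "3 \<le> k" "k \<le> n"
  shows "s * k * card (cycles n k) = (\<Prod>i<k. n - i)"
proof -
  define D where "D = (\<lambda>r. {xs \<in> vertex_lists n k. xs ! r = Min (set xs)})"
  have finD: "finite (D r)" for r unfolding D_def using finite_vertex_lists by simp
  have rot: "card (D r) = card (D 0)" if r: "r < k" for r
  proof (rule bij_betw_same_card[of "rotate r"], rule bij_betw_byWitness[where f' = "rotate (k - r)"])
    have rr: "rotate k xs = xs" if "xs \<in> D a" for xs a
      using that unfolding D_def vertex_lists_def by auto
    show "\<forall>xs\<in>D r. rotate (k - r) (rotate r xs) = xs"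
      using r rr by (auto simp: rotate_rotate)
    show "\<forall>xs\<in>D 0. rotate r (rotate (k - r) xs) = xs"
      using r rr by (auto simp: rotate_rotate)
    have nth: "rotate a xs ! i = xs ! ((a + i) mod k)" if "i < k" "xs \<in> D b" for a b i xs
      using that nth_rotate[of i xs a] unfolding D_def vertex_lists_def by auto
    show "rotate r ` D r \<subseteq> D 0"
      using r nth[of 0 _ r r] vertex_lists_rotate unfolding D_def by auto
    show "rotate (k - r) ` D 0 \<subseteq> D r"
      using r nth[of r _ 0 "k - r"] vertex_lists_rotate unfolding D_def by auto
  qed
  have U: "vertex_lists n k = (\<Union>r<k. D r)"
    using ex_min_nth k unfolding D_def by fastforce
  have dis: "D i \<inter> D j = {}" if "i < k" "j < k" "i \<noteq> j" for i j
  proof (rule ccontr)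
    assume "D i \<inter> D j \<noteq> {}"
    then obtain xs where "xs \<in> D i" "xs \<in> D j" by auto
    then have "xs ! i = xs ! j" "distinct xs" "length xs = k"
      unfolding D_def vertex_lists_def by auto
    then show False using that by (simp add: nth_eq_iff_index_eq)
  qed
  have "card (vertex_lists n k) = (\<Sum>r<k. card (D r))"
    unfolding U using finD dis by (intro card_UN_disjoint) auto
  also have "\<dots> = (\<Sum>r<k. card (D 0))" by (intro sum.cong refl rot) simp
  also have "\<dots> = k * card (D 0)" by simp
  finally have 1: "card (vertex_lists n k) = k * card (D 0)" .
  have 2: "card (D 0) = s * card (cycles n k)"
  proof (cases "s = 2")
    case False
    then have "cycles n k = D 0" "s = 1" using s_cases unfolding cycles_def canonical_def D_def by auto
    then show ?thesis by simp
  next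
    case s2: True
    have ne: "xs \<noteq> []" "2 \<le> length xs" if "xs \<in> vertex_lists n k" for xs
      using that k unfolding vertex_lists_def by auto
    have "D 0 = cycles n k \<union> flip ` cycles n k"
    proof (intro equalityI subsetI)
      fix xs assume xs: "xs \<in> D 0"
      then have v: "xs \<in> vertex_lists n k" unfolding D_def by simp
      show "xs \<in> cycles n k \<union> flip ` cycles n k"
      proof (cases "xs ! 1 < last xs")
        case False
        then have "flip xs \<in> cycles n k"
          using xs flip_vertex_lists[OF v] flip_ends[of xs] ne[OF v] last_neq_second[OF v k(1)]
          unfolding cycles_def canonical_def D_def by auto
        then show ?thesis using flip_flip[of xs] ne[OF v] by (metis UnI2 imageI)
      qed (use xs in \<open>auto simp: D_def cycles_def canonical_def\<close>)
    next
      fix xs assume "xs \<in> cycles n k \<union> flip ` cycles n k"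
      then show "xs \<in> D 0"
        using flip_vertex_lists flip_ends ne unfolding cycles_def canonical_def D_def by auto
    qed
    moreover have "cycles n k \<inter> flip ` cycles n k = {}"
      using flip_ends(3,4) ne s2 unfolding cycles_def canonical_def by fastforce
    moreover have "card (flip ` cycles n k) = card (cycles n k)"
      using flip_flip ne unfolding cycles_def by (intro card_image inj_on_inverseI[of _ flip]) auto
    ultimately show ?thesis using s2 finite_cycles[of n k]
      by (simp add: card_Un_disjoint)
  qed
  have "card (vertex_lists n k) = \<Prod>{n - k + 1..n}"
    using card_lists_distinct_length_eq[of "{..<n}" k] k unfolding vertex_lists_def by simp
  also have "\<dots> = (\<Prod>i<k. n - i)"
    using k by (intro prod.reindex_bij_witness[of _ "\<lambda>i. n - i" "\<lambda>i. n - i"]) auto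
  finally show ?thesis using 1 2 by (simp add: mult_ac)
qed

end

section \<open>Cycles of bounded length\<close>

text \<open>
  With \<open>w = c / n\<close> the bound does not depend on \<open>n\<close>. A new entry of the list either repeats one of at
  most \<open>m\<close> old vertices, or is one of \<open>n\<close> vertices at the price of one more factor \<open>w\<close>.
\<close>

lemma sum_power_card_set_lists:
  fixes w :: real
  assumes "0 \<le> w"
  shows "(\<Sum>zs | set zs \<subseteq> {..<n} \<and> length zs = m. w ^ card (set zs)) \<le> (\<Prod>i<m. real n * w + real i)"
proof (induction m)
  case 0
  have "{zs::nat list. set zs \<subseteq> {..<n} \<and> length zs = 0} = {[]}" by auto
  then show ?case by simp
next
  case (Suc m)
  let ?L = "\<lambda>m. {zs::nat list. set zs \<subseteq> {..<n} \<and> length zs = m}"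
  have fin: "finite (?L m)" for m using finite_lists_length_eq[of "{..<n}" m] by simp
  have "?L (Suc m) = (\<lambda>(zs, x). x # zs) ` (?L m \<times> {..<n})"
  proof (intro equalityI subsetI)
    fix zs assume "zs \<in> ?L (Suc m)"
    then show "zs \<in> (\<lambda>(zs, x). x # zs) ` (?L m \<times> {..<n})"
      by (cases zs) (auto intro!: image_eqI[of _ _ "(tl zs, hd zs)"])
  qed auto
  moreover have "inj_on (\<lambda>(zs, x). x # zs) (?L m \<times> {..<n})" by (auto simp: inj_on_def)
  ultimately have "(\<Sum>zs\<in>?L (Suc m). w ^ card (set zs)) =
      (\<Sum>(zs, x)\<in>?L m \<times> {..<n}. w ^ card (insert x (set zs)))"
    by (simp add: sum.reindex case_prod_unfold)
  also have "\<dots> = (\<Sum>zs\<in>?L m. \<Sum>x<n. w ^ card (insert x (set zs)))"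
    by (simp add: sum.cartesian_product)
  also have "\<dots> \<le> (\<Sum>zs\<in>?L m. (real n * w + real m) * w ^ card (set zs))"
  proof (rule sum_mono)
    fix zs assume zs: "zs \<in> ?L m"
    have "(\<Sum>x<n. w ^ card (insert x (set zs))) \<le>
        (\<Sum>x<n. w * w ^ card (set zs) + (if x \<in> set zs then w ^ card (set zs) else 0))"
      using assms by (intro sum_mono) (auto simp: insert_absorb)
    also have "\<dots> = real n * w * w ^ card (set zs) + real (card (set zs)) * w ^ card (set zs)"
      using zs by (simp add: sum.distrib sum.If_cases Int_absorb1)
    also have "\<dots> \<le> (real n * w + real m) * w ^ card (set zs)"
      using zs assms card_length[of zs] by (simp add: distrib_right mult_right_mono)
    finally show "(\<Sum>x<n. w ^ card (insert x (set zs))) \<le> (real n * w + real m) * w ^ card (set zs)" .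
  qed
  also have "\<dots> = (real n * w + real m) * (\<Sum>zs\<in>?L m. w ^ card (set zs))"
    by (simp add: sum_distrib_left)
  also have "\<dots> \<le> (real n * w + real m) * (\<Prod>i<m. real n * w + real i)"
    using Suc assms by (intro mult_left_mono) auto
  finally show ?case by (simp add: mult.commute)
qed

text \<open>
  The sandwich comes from \<open>exp (- x / (1 - x)) \<le> 1 - x \<le> exp (- x)\<close>.
\<close>

lemma tendsto_one_minus_power:
  fixes x :: "nat \<Rightarrow> real" and N :: "nat \<Rightarrow> nat"
  assumes x: "x \<longlonglongrightarrow> 0" and Nx: "(\<lambda>n. real (N n) * x n) \<longlonglongrightarrow> l" and pos: "\<And>n. 0 \<le> x n"
  shows "(\<lambda>n. (1 - x n) ^ N n) \<longlonglongrightarrow> exp (- l)"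
proof (rule tendsto_sandwich)
  have ev: "\<forall>\<^sub>F n in sequentially. x n < 1" using x by (rule order_tendstoD) simp
  show "\<forall>\<^sub>F n in sequentially. exp (- (real (N n) * x n / (1 - x n))) \<le> (1 - x n) ^ N n"
    using ev
  proof eventually_elim
    case (elim n)
    have "inverse (1 - x n) = 1 + x n / (1 - x n)" using elim by (simp add: field_simps)
    also have "\<dots> \<le> exp (x n / (1 - x n))" by (rule exp_ge_add_one_self)
    finally have "inverse (exp (x n / (1 - x n))) \<le> inverse (inverse (1 - x n))"
      using elim by (intro le_imp_inverse_le) auto
    then have "exp (- (x n / (1 - x n))) \<le> 1 - x n" by (simp add: exp_minus)
    then have "exp (- (x n / (1 - x n))) ^ N n \<le> (1 - x n) ^ N n" by (intro power_mono) auto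
    then show ?case by (simp flip: exp_of_nat_mult)
  qed
  show "\<forall>\<^sub>F n in sequentially. (1 - x n) ^ N n \<le> exp (- (real (N n) * x n))"
    using ev
  proof eventually_elim
    case (elim n)
    have "1 - x n \<le> exp (- x n)" using exp_ge_add_one_self[of "- x n"] by simp
    then have "(1 - x n) ^ N n \<le> exp (- x n) ^ N n" using elim by (intro power_mono) auto
    then show ?case by (simp flip: exp_of_nat_mult)
  qed
  have "(\<lambda>n. - (real (N n) * x n / (1 - x n))) \<longlonglongrightarrow> - (l / (1 - 0))"
    by (intro tendsto_intros Nx x) simp
  then show "(\<lambda>n. exp (- (real (N n) * x n / (1 - x n)))) \<longlonglongrightarrow> exp (- l)"
    by (intro tendsto_exp) simp
  show "(\<lambda>n. exp (- (real (N n) * x n))) \<longlonglongrightarrow> exp (- l)"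
    by (intro tendsto_intros Nx)
qed

context cycle_keys begin

definition keys :: "nat \<Rightarrow> 'k set" where
  "keys n = {key u v |u v. u < n \<and> v < n \<and> u \<noteq> v}"

definition flips :: "nat \<Rightarrow> real \<Rightarrow> ('k \<Rightarrow> bool) pmf" where
  "flips n p = Pi_pmf (keys n) False (\<lambda>_. bernoulli_pmf p)"

lemma finite_keys: "finite (keys n)"
proof -
  have "keys n \<subseteq> (\<lambda>(u, v). key u v) ` ({..<n} \<times> {..<n})" unfolding keys_def by auto
  then show ?thesis by (rule finite_subset) simp
qed

lemma cyc_keys_subset_keys:
  assumes "xs \<in> vertex_lists n k" "2 \<le> k"
  shows "cyc_keys xs \<subseteq> keys n"
proof
  fix e assume "e \<in> cyc_keys xs"
  then obtain i where i: "i < length xs" "e = key (xs ! i) (xs ! (Suc i mod length xs))"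
    unfolding cyc_keys_def by auto
  have xs: "length xs = k" "distinct xs" "set xs \<subseteq> {..<n}" using assms by (auto simp: vertex_lists_def)
  have l: "Suc i mod length xs < length xs" using i by (intro Suc_mod_less)
  have "i \<noteq> Suc i mod length xs" using i xs assms(2) by (cases "Suc i = length xs") auto
  then have "xs ! i \<noteq> xs ! (Suc i mod length xs)" using i l xs by (simp add: nth_eq_iff_index_eq)
  moreover have "xs ! i < n" "xs ! (Suc i mod length xs) < n"
    using nth_mem[OF i(1)] nth_mem[OF l] xs by auto
  ultimately show "e \<in> keys n" unfolding keys_def i(2) by blast
qed

text \<open>
  The error term of \<open>avoid_all_approx\<close>. The additional factor \<open>p\<close> is the surplus of edges over vertices
  in the union of two distinct cycles that share an edge; the rest is bounded independently of \<open>n\<close>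
  when \<open>n * p\<close> is constant, by a sum over the concatenated lists.
\<close>

lemma sum_overlapping_pairs_le:
  assumes "3 \<le> k" "3 \<le> m" and p: "0 \<le> p" "p \<le> 1"
  shows "(\<Sum>xs\<in>cycles n k. \<Sum>ys | ys \<in> cycles n m \<and> ys \<noteq> xs \<and> cyc_keys xs \<inter> cyc_keys ys \<noteq> {}.
      p ^ card (cyc_keys xs \<union> cyc_keys ys)) \<le> p * (\<Prod>i<k+m. real n * p + real i)"
proof -
  define Y where "Y = (\<lambda>xs. {ys. ys \<in> cycles n m \<and> ys \<noteq> xs \<and> cyc_keys xs \<inter> cyc_keys ys \<noteq> {}})"
  have finY: "finite (Y xs)" for xs unfolding Y_def using finite_cycles by simp
  have "(\<Sum>xs\<in>cycles n k. \<Sum>ys\<in>Y xs. p ^ card (cyc_keys xs \<union> cyc_keys ys)) \<le>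
      (\<Sum>xs\<in>cycles n k. \<Sum>ys\<in>Y xs. p * p ^ card (set (xs @ ys)))"
  proof (intro sum_mono)
    fix xs ys assume xs: "xs \<in> cycles n k" and ys: "ys \<in> Y xs"
    have "card (set (xs @ ys)) + 1 \<le> card (cyc_keys xs \<union> cyc_keys ys)"
      by (rule card_cyc_keys_Un[OF xs, of ys m]) (use ys assms in \<open>auto simp: Y_def\<close>)
    then have "p ^ card (cyc_keys xs \<union> cyc_keys ys) \<le> p ^ (card (set (xs @ ys)) + 1)"
      using p by (intro power_decreasing)
    then show "p ^ card (cyc_keys xs \<union> cyc_keys ys) \<le> p * p ^ card (set (xs @ ys))" by simp
  qed
  also have "\<dots> = (\<Sum>(xs, ys)\<in>Sigma (cycles n k) Y. p * p ^ card (set (xs @ ys)))"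
    using finY finite_cycles by (subst sum.Sigma) auto
  also have "\<dots> = (\<Sum>zs\<in>(\<lambda>(xs, ys). xs @ ys) ` Sigma (cycles n k) Y. p * p ^ card (set zs))"
  proof -
    have "inj_on (\<lambda>(xs, ys). xs @ ys) (Sigma (cycles n k) Y)"
      by (auto simp: inj_on_def cycles_def vertex_lists_def)
    then show ?thesis by (simp add: sum.reindex case_prod_unfold)
  qed
  also have "\<dots> \<le> (\<Sum>zs | set zs \<subseteq> {..<n} \<and> length zs = k + m. p * p ^ card (set zs))"
    using p finite_lists_length_eq[of "{..<n}" "k + m"]
    by (intro sum_mono2) (auto simp: cycles_def vertex_lists_def Y_def)
  also have "\<dots> = p * (\<Sum>zs | set zs \<subseteq> {..<n} \<and> length zs = k + m. p ^ card (set zs))"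
    by (simp add: sum_distrib_left)
  also have "\<dots> \<le> p * (\<Prod>i<k+m. real n * p + real i)"
    using p by (intro mult_left_mono sum_power_card_set_lists)
  finally show ?thesis unfolding Y_def .
qed

lemma prob_no_cycles_approx:
  assumes S: "finite S" "S \<subseteq> {3..}" and p: "0 \<le> p" "p \<le> 1"
  shows "\<bar>measure_pmf.prob (flips n p) {f. \<forall>k\<in>S. \<not> has_cycle n k f}
      - (\<Prod>k\<in>S. (1 - p ^ k) ^ card (cycles n k))\<bar>
    \<le> p * (\<Sum>k\<in>S. \<Sum>m\<in>S. \<Prod>i<k+m. real n * p + real i)"
proof -
  define I where "I = (\<Union>k\<in>S. cycles n k)"
  have dis: "cycles n k \<inter> cycles n m = {}" if "k \<noteq> m" for k m
    using that unfolding cycles_def vertex_lists_def by auto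
  have finI: "finite I" unfolding I_def using S finite_cycles by simp
  have ev: "{f. \<forall>k\<in>S. \<not> has_cycle n k f} = {f. \<forall>xs\<in>I. \<not> (\<forall>e\<in>cyc_keys xs. f e)}"
  proof -
    have "has_cycle n k f \<longleftrightarrow> (\<exists>xs\<in>cycles n k. \<forall>e\<in>cyc_keys xs. f e)" if "k \<in> S" for k f
      using has_cycle_iff_cycles[of k] S that by auto
    then show ?thesis unfolding I_def by blast
  qed
  have sub: "cyc_keys xs \<subseteq> keys n" if xs: "xs \<in> I" for xs
  proof -
    obtain k where "k \<in> S" "xs \<in> cycles n k" using xs unfolding I_def by auto
    moreover from this have "2 \<le> k" using S by force
    ultimately show ?thesis using cyc_keys_subset_keys[of xs n k] unfolding cycles_def by simp
  qed
  have prd: "(\<Prod>xs\<in>I. 1 - p ^ card (cyc_keys xs)) = (\<Prod>k\<in>S. (1 - p ^ k) ^ card (cycles n k))"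
  proof -
    have "(\<Prod>xs\<in>I. 1 - p ^ card (cyc_keys xs)) = (\<Prod>k\<in>S. \<Prod>xs\<in>cycles n k. 1 - p ^ card (cyc_keys xs))"
      unfolding I_def using S dis finite_cycles by (intro prod.UNION_disjoint) auto
    also have "\<dots> = (\<Prod>k\<in>S. \<Prod>xs\<in>cycles n k. 1 - p ^ k)"
      using S by (intro prod.cong refl) (auto simp: cycles_def vertex_lists_def card_cyc_keys)
    finally show ?thesis by simp
  qed
  have sm: "(\<Sum>xs\<in>I. \<Sum>ys | ys \<in> I \<and> ys \<noteq> xs \<and> cyc_keys xs \<inter> cyc_keys ys \<noteq> {}.
      p ^ card (cyc_keys xs \<union> cyc_keys ys)) \<le> (\<Sum>k\<in>S. \<Sum>m\<in>S. p * (\<Prod>i<k+m. real n * p + real i))"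
  proof -
    let ?Y = "\<lambda>m xs. {ys. ys \<in> cycles n m \<and> ys \<noteq> xs \<and> cyc_keys xs \<inter> cyc_keys ys \<noteq> {}}"
    let ?g = "\<lambda>xs ys. p ^ card (cyc_keys xs \<union> cyc_keys ys)"
    have "(\<Sum>xs\<in>I. \<Sum>ys | ys \<in> I \<and> ys \<noteq> xs \<and> cyc_keys xs \<inter> cyc_keys ys \<noteq> {}. ?g xs ys)
      = (\<Sum>xs\<in>I. \<Sum>ys\<in>(\<Union>m\<in>S. ?Y m xs). ?g xs ys)"
      unfolding I_def by (intro sum.cong refl) auto
    also have "\<dots> = (\<Sum>xs\<in>I. \<Sum>m\<in>S. \<Sum>ys\<in>?Y m xs. ?g xs ys)"
      by (intro sum.cong refl sum.UNION_disjoint ballI impI)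
        (use S in simp, use finite_cycles in simp, use dis in blast)
    also have "\<dots> = (\<Sum>k\<in>S. \<Sum>xs\<in>cycles n k. \<Sum>m\<in>S. \<Sum>ys\<in>?Y m xs. ?g xs ys)"
      unfolding I_def using S dis finite_cycles by (intro sum.UNION_disjoint) auto
    also have "\<dots> = (\<Sum>k\<in>S. \<Sum>m\<in>S. \<Sum>xs\<in>cycles n k. \<Sum>ys\<in>?Y m xs. ?g xs ys)"
      by (intro sum.cong refl sum.swap)
    also have "\<dots> \<le> (\<Sum>k\<in>S. \<Sum>m\<in>S. p * (\<Prod>i<k+m. real n * p + real i))"
      using S p by (intro sum_mono sum_overlapping_pairs_le) auto
    finally show ?thesis .
  qed
  show ?thesis
    using avoid_all_approx[where E = cyc_keys, OF finite_keys finI sub p] sm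
    unfolding ev prd flips_def by (simp add: sum_distrib_left)
qed

text \<open>
  There are \<open>n * (n - 1) * ... * (n - k + 1) / (s * k)\<close> possible cycles, which is asymptotically
  \<open>n ^ k / (s * k)\<close>.
\<close>

lemma tendsto_no_k_cycle_factor:
  assumes "3 \<le> k" "0 < c"
  shows "(\<lambda>n. (1 - (c / real n) ^ k) ^ card (cycles n k)) \<longlonglongrightarrow> exp (- (c ^ k / real (s * k)))"
proof (rule tendsto_one_minus_power)
  have "(\<lambda>n. c / real n) \<longlonglongrightarrow> 0" by (rule lim_const_over_n)
  then have "(\<lambda>n. (c / real n) ^ k) \<longlonglongrightarrow> 0 ^ k" by (intro tendsto_intros)
  then show "(\<lambda>n. (c / real n) ^ k) \<longlonglongrightarrow> 0" using assms by (simp add: power_0_left)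
  have sk: "0 < s * k" using s_cases assms by auto
  have lim1: "(\<lambda>n. real (n - i) * c / real n) \<longlonglongrightarrow> c" for i
  proof -
    have "(\<lambda>n. c - real i * c / real n) \<longlonglongrightarrow> c - 0" by (intro tendsto_intros lim_const_over_n)
    moreover have "\<forall>\<^sub>F n in sequentially. c - real i * c / real n = real (n - i) * c / real n"
      using eventually_ge_at_top[of "max 1 i"]
      by eventually_elim (auto simp: field_simps of_nat_diff)
    ultimately show ?thesis by (simp add: filterlim_cong)
  qed
  have "(\<lambda>n. (\<Prod>i<k. real (n - i) * c / real n) / real (s * k)) \<longlonglongrightarrow> (\<Prod>i<k. c) / real (s * k)"
    using sk by (intro tendsto_intros lim1) auto
  moreover have "\<forall>\<^sub>F n in sequentially. (\<Prod>i<k. real (n - i) * c / real n) / real (s * k)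
      = real (card (cycles n k)) * (c / real n) ^ k"
    using eventually_ge_at_top[of k]
  proof eventually_elim
    case (elim n)
    have "real (s * k) * real (card (cycles n k)) = (\<Prod>i<k. real (n - i))"
      using card_cycles[OF assms(1) elim] by (simp flip: of_nat_mult of_nat_prod)
    moreover have "(\<Prod>i<k. real (n - i) * c / real n) = (\<Prod>i<k. real (n - i)) * (c / real n) ^ k"
      by (simp add: prod.distrib flip: times_divide_eq_right)
    ultimately have "(\<Prod>i<k. real (n - i) * c / real n) = real (s * k) * (real (card (cycles n k)) * (c / real n) ^ k)"
      by (metis mult.assoc)
    then show ?case using sk by simp
  qed
  ultimately show "(\<lambda>n. real (card (cycles n k)) * (c / real n) ^ k) \<longlonglongrightarrow> c ^ k / real (s * k)"
    by (simp add: filterlim_cong)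
  show "0 \<le> (c / real n) ^ k" for n using assms by simp
qed

lemma prob_no_cycles_tendsto:
  assumes S: "finite S" "S \<subseteq> {3..}" and c: "0 < c"
  shows "(\<lambda>n. measure_pmf.prob (flips n (c / real n)) {f. \<forall>k\<in>S. \<not> has_cycle n k f})
    \<longlonglongrightarrow> (\<Prod>k\<in>S. exp (- (c ^ k / real (s * k))))"
proof -
  define R where "R = (\<lambda>n. \<Prod>k\<in>S. (1 - (c / real n) ^ k) ^ card (cycles n k))"
  define P where "P = (\<lambda>n. measure_pmf.prob (flips n (c / real n)) {f. \<forall>k\<in>S. \<not> has_cycle n k f})"
  have "(\<lambda>n. P n - R n) \<longlonglongrightarrow> 0"
  proof (rule Lim_null_comparison)
    let ?C = "\<Sum>k\<in>S. \<Sum>m\<in>S. \<Prod>i<k+m. c + real i"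
    show "\<forall>\<^sub>F n in sequentially. norm (P n - R n) \<le> c / real n * ?C"
      using eventually_ge_at_top[of "max 1 (nat \<lceil>c\<rceil>)"]
    proof eventually_elim
      case (elim n)
      then have n: "0 < real n" "c \<le> real n" by linarith+
      then show ?case
        using prob_no_cycles_approx[OF S, of "c / real n" n] c unfolding P_def R_def by simp
    qed
    have "(\<lambda>n. c / real n * ?C) \<longlonglongrightarrow> 0 * ?C" by (intro tendsto_intros lim_const_over_n)
    then show "(\<lambda>n. c / real n * ?C) \<longlonglongrightarrow> 0" by simp
  qed
  moreover have "R \<longlonglongrightarrow> (\<Prod>k\<in>S. exp (- (c ^ k / real (s * k))))"
    unfolding R_def using S c by (intro tendsto_prod tendsto_no_k_cycle_factor) auto
  ultimately have "(\<lambda>n. P n - R n + R n) \<longlonglongrightarrow> 0 + (\<Prod>k\<in>S. exp (- (c ^ k / real (s * k))))"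
    by (rule tendsto_add)
  then show ?thesis unfolding P_def by simp
qed

text \<open>
  Inclusion and exclusion in recursive form: the outcomes in which \<open>b\<close> occurs are those without a
  condition on \<open>b\<close> minus those in which \<open>b\<close> is missing. The set \<open>S\<close> of forbidden lengths
  makes the induction possible.
\<close>

lemma prob_cycle_lengths_tendsto:
  assumes B: "finite B" "B \<subseteq> {3..}" and c: "0 < c"
  shows "finite S \<Longrightarrow> S \<subseteq> {3..} \<Longrightarrow> S \<inter> B = {} \<Longrightarrow>
    (\<lambda>n. measure_pmf.prob (flips n (c / real n))
       {f. (\<forall>k\<in>S. \<not> has_cycle n k f) \<and> (\<forall>k\<in>B. has_cycle n k f)})
    \<longlonglongrightarrow> (\<Prod>k\<in>S. exp (- (c ^ k / real (s * k)))) * (\<Prod>k\<in>B. 1 - exp (- (c ^ k / real (s * k))))"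
  using B
proof (induction B arbitrary: S rule: finite_induct)
  case empty
  then show ?case using prob_no_cycles_tendsto c by simp
next
  case (insert b B)
  let ?e = "\<lambda>k. exp (- (c ^ k / real (s * k)))"
  let ?X = "\<lambda>n S. {f. (\<forall>k\<in>S. \<not> has_cycle n k f) \<and> (\<forall>k\<in>B. has_cycle n k f)}"
  have 1: "(\<lambda>n. measure_pmf.prob (flips n (c / real n)) (?X n S)) \<longlonglongrightarrow> (\<Prod>k\<in>S. ?e k) * (\<Prod>k\<in>B. 1 - ?e k)"
    using insert by (intro insert.IH) auto
  have 2: "(\<lambda>n. measure_pmf.prob (flips n (c / real n)) (?X n (insert b S)))
      \<longlonglongrightarrow> (\<Prod>k\<in>insert b S. ?e k) * (\<Prod>k\<in>B. 1 - ?e k)"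
    using insert by (intro insert.IH) auto
  have "measure_pmf.prob (flips n (c / real n))
      {f. (\<forall>k\<in>S. \<not> has_cycle n k f) \<and> (\<forall>k\<in>insert b B. has_cycle n k f)} =
    measure_pmf.prob (flips n (c / real n)) (?X n S) - measure_pmf.prob (flips n (c / real n)) (?X n (insert b S))" for n
  proof -
    have "{f. (\<forall>k\<in>S. \<not> has_cycle n k f) \<and> (\<forall>k\<in>insert b B. has_cycle n k f)} = ?X n S - ?X n (insert b S)"
      by auto
    then show ?thesis by (simp only:) (rule measure_pmf.finite_measure_Diff, auto)
  qed
  then have "(\<lambda>n. measure_pmf.prob (flips n (c / real n))
      {f. (\<forall>k\<in>S. \<not> has_cycle n k f) \<and> (\<forall>k\<in>insert b B. has_cycle n k f)}) \<longlonglongrightarrow>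
      (\<Prod>k\<in>S. ?e k) * (\<Prod>k\<in>B. 1 - ?e k) - (\<Prod>k\<in>insert b S. ?e k) * (\<Prod>k\<in>B. 1 - ?e k)"
    using tendsto_diff[OF 1 2] by simp
  moreover have "b \<notin> S" using insert by auto
  ultimately show ?case using insert.hyps insert.prems by (simp add: algebra_simps)
qed

end

section \<open>Long cycles from a long path and random chords\<close>

text \<open>
  The factors of the theta product tend to 1 doubly exponentially fast, which is where \<open>c > 1\<close> enters.
\<close>

lemma summable_exp_neg_power:
  fixes c :: real
  assumes "1 < c" "0 < s"
  shows "summable (\<lambda>k. exp (- (c ^ k / (s * real k))))"
proof (rule summable_comparison_test_bigo)
  show "summable (\<lambda>k. norm (1 / real k ^ 2))"
    using inverse_power_summable[of 2, where 'a = real] by (simp add: inverse_eq_divide)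
  show "(\<lambda>k. exp (- (c ^ k / (s * real k)))) \<in> O(\<lambda>k. 1 / real k ^ 2)"
    using assms by real_asymp
qed

lemma partial_products_tendsto_prodinf:
  fixes e :: "nat \<Rightarrow> real"
  assumes "summable e" "\<And>k. l \<le> k \<Longrightarrow> 0 \<le> e k"
  shows "(\<lambda>K. \<Prod>k=l..<K. 1 - e k) \<longlonglongrightarrow> (\<Prod>j. 1 - e (l + j))"
proof -
  have "summable (\<lambda>j. norm ((1 - e (l + j)) - 1))"
    using summable_ignore_initial_segment[OF assms(1), of l] assms(2) by (simp add: add.commute)
  then have "abs_convergent_prod (\<lambda>j. 1 - e (l + j))"
    by (rule summable_imp_abs_convergent_prod)
  then have "convergent_prod (\<lambda>j. 1 - e (l + j))"
    by (rule abs_convergent_prod_imp_convergent_prod)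
  then have lim: "(\<lambda>n. \<Prod>j\<le>n. 1 - e (l + j)) \<longlonglongrightarrow> (\<Prod>j. 1 - e (l + j))"
    by (rule convergent_prod_LIMSEQ)
  have "(\<Prod>j\<le>n. 1 - e (l + j)) = (\<Prod>k=l..<n + Suc l. 1 - e k)" for n
    by (rule prod.reindex_bij_witness[of _ "\<lambda>k. k - l" "\<lambda>j. l + j"]) auto
  then have "(\<lambda>n. \<Prod>k=l..<n + Suc l. 1 - e k) \<longlonglongrightarrow> (\<Prod>j. 1 - e (l + j))"
    using lim by simp
  then show ?thesis by (rule LIMSEQ_offset)
qed

lemma sum_exp_tail_le:
  fixes \<rho> :: real
  assumes "0 < \<rho>" "finite B" "B \<subseteq> {K..}"
  shows "(\<Sum>k\<in>B. exp (- (\<rho> * real k))) \<le> exp (- \<rho>) ^ K / (1 - exp (- \<rho>))"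
proof -
  have e: "exp (- (\<rho> * real k)) = exp (- \<rho>) ^ k" for k
    by (simp add: mult.commute flip: exp_of_nat_mult)
  have s: "(\<lambda>j. exp (- \<rho>) ^ K * exp (- \<rho>) ^ j) sums (exp (- \<rho>) ^ K * (1 / (1 - exp (- \<rho>))))"
    using assms(1) by (intro sums_mult geometric_sums) simp
  have "(\<Sum>k\<in>B. exp (- (\<rho> * real k))) = (\<Sum>j\<in>(\<lambda>k. k - K) ` B. exp (- \<rho>) ^ K * exp (- \<rho>) ^ j)"
  proof (subst sum.reindex)
    show "inj_on (\<lambda>k. k - K) B" using assms(3) by (auto simp: inj_on_def subset_iff) (metis le_add_diff_inverse)
    show "(\<Sum>k\<in>B. exp (- (\<rho> * real k))) =
        sum ((\<lambda>j. exp (- \<rho>) ^ K * exp (- \<rho>) ^ j) \<circ> (\<lambda>k. k - K)) B"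
      using assms(3) unfolding e by (intro sum.cong refl) (auto simp flip: power_add)
  qed
  also have "\<dots> \<le> exp (- \<rho>) ^ K * (1 / (1 - exp (- \<rho>)))"
    unfolding sums_unique[OF s] using assms(2) by (intro sum_le_suminf sums_summable[OF s]) auto
  finally show ?thesis by simp
qed

context cycle_keys begin

definition open_path :: "nat \<Rightarrow> nat list \<Rightarrow> ('k \<Rightarrow> bool) \<Rightarrow> bool" where
  "open_path n xs f \<longleftrightarrow> distinct xs \<and> set xs \<subseteq> {..<n} \<and>
     (\<forall>i. Suc i < length xs \<longrightarrow> f (key (xs ! i) (xs ! Suc i)))"

lemma has_cycle_imp_open_path:
  assumes "has_cycle n k f"
  shows "\<exists>xs. open_path n xs f \<and> length xs = k"
proof -
  obtain xs where xs: "xs \<in> vertex_lists n k" and f: "\<forall>e\<in>cyc_keys xs. f e"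
    using assms unfolding has_cycle_def by auto
  have "f (key (xs ! i) (xs ! Suc i))" if "Suc i < length xs" for i
  proof -
    have "key (xs ! i) (xs ! (Suc i mod length xs)) \<in> cyc_keys xs"
      unfolding cyc_keys_def using that by (intro imageI) simp
    then show ?thesis using f that by simp
  qed
  then show ?thesis using xs unfolding open_path_def vertex_lists_def by auto
qed

text \<open>
  The cycle runs from \<open>i\<close> to \<open>u\<close> along the path, jumps to \<open>v\<close>, runs on to \<open>j\<close> and jumps back
  to \<open>i\<close>. Its orientation agrees with the path throughout.
\<close>

lemma has_cycle_two_chords:
  assumes path: "open_path n xs f" and pos: "i \<le> u" "u < v" "v \<le> j" "j < length xs"
    and chords: "f (key (xs ! u) (xs ! v))" "f (key (xs ! j) (xs ! i))"
  shows "has_cycle n ((u - i + 1) + (j - v + 1)) f"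
proof -
  define a where "a = u - i + 1"
  define k where "k = a + (j - v + 1)"
  define idx where "idx = (\<lambda>t. if t < a then i + t else v + (t - a))"
  define zs where "zs = map (\<lambda>t. xs ! idx t) [0..<k]"
  have ia: "i + a = Suc u" using pos unfolding a_def by simp
  have vk: "v + (k - a) = Suc j" using pos unfolding k_def by simp
  have idx: "idx t < length xs" if "t < k" for t
    using that pos unfolding idx_def k_def a_def by (auto split: if_splits)
  have inj: "inj_on idx {..<k}"
    using pos ia unfolding inj_on_def idx_def by auto
  have "distinct zs"
  proof -
    have "inj_on (\<lambda>t. xs ! idx t) {..<k}"
      using inj idx path unfolding inj_on_def open_path_def by (simp add: nth_eq_iff_index_eq)
    then show ?thesis unfolding zs_def by (simp add: distinct_map atLeast0LessThan)
  qed
  moreover have "set zs \<subseteq> {..<n}"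
    using idx path nth_mem unfolding zs_def open_path_def by (fastforce simp: subset_iff)
  moreover have "f (key (zs ! t) (zs ! (Suc t mod k)))" if t: "t < k" for t
  proof -
    have step: "f (key (xs ! idx t) (xs ! idx (Suc t mod k)))"
    proof (cases "Suc t = k")
      case True
      then have "idx t = j" "idx (Suc t mod k) = i"
        using pos unfolding idx_def k_def a_def by auto
      then show ?thesis using chords by simp
    next
      case False
      then have st: "Suc t mod k = Suc t" "Suc t < k" using t by auto
      show ?thesis
      proof (cases "Suc t = a")
        case True
        then have "idx t = u" "idx (Suc t) = v" using ia unfolding idx_def by auto
        then show ?thesis using chords st by simp
      next
        case ne: False
        then have "idx (Suc t) = Suc (idx t)" unfolding idx_def by auto
        then show ?thesis using idx[of "Suc t"] st path unfolding open_path_def by simp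
      qed
    qed
    have "Suc t mod k < k" using t by (rule Suc_mod_less)
    then show ?thesis using step t unfolding zs_def by simp
  qed
  moreover have "length zs = k" unfolding zs_def by simp
  ultimately have "has_cycle n k f"
    unfolding has_cycle_def vertex_lists_def cyc_keys_def by (intro bexI[of _ zs]) auto
  then show ?thesis unfolding k_def a_def by simp
qed

text \<open>
  For each difference \<open>d\<close> consider forward chords from position \<open>2 * a\<close> to \<open>2 * a + d\<close> and backward
  chords from \<open>b + d + (k - 2)\<close> to \<open>b\<close>, where \<open>b\<close> runs through the \<open>m\<close> odd positions just below
  \<open>2 * a\<close>. Any such pair closes a cycle of length exactly \<open>k\<close>. The difference of its positions
  determines \<open>d\<close> for a chord of a known kind. The kind is read off from the parity of the smaller
  position, since forward and backward chords with the same pair of positions share a coin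
  in the undirected case. Hence the keys for different \<open>d\<close> and the keys of the two kinds are
  disjoint. The condition on the length of the path ensures that all the chords fit.
\<close>

lemma prob_no_k_cycle_after_sprinkling:
  assumes path: "open_path n xs f" and q: "0 \<le> q" "q \<le> 1"
    and m: "2 * m < k" and len: "2 * (m + w) + D + k \<le> length xs"
  shows "measure_pmf.prob (flips n q) {g. \<not> has_cycle n k (\<lambda>e. f e \<or> g e)}
    \<le> (1 - (1 - (1 - q) ^ w) * (1 - (1 - q) ^ m)) ^ D"
proof -
  let ?L = "length xs"
  define fwd where "fwd = (\<lambda>d a. key (xs ! a) (xs ! (a + d)))"
  define bwd where "bwd = (\<lambda>d b. key (xs ! (b + d + (k - 2))) (xs ! b))"
  define F where "F = (\<lambda>d. fwd d ` {a. even a \<and> a + d < ?L})"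
  define G where "G = (\<lambda>d. bwd d ` {b. odd b \<and> b + d + (k - 2) < ?L})"
  define X where "X = (\<lambda>d g. \<exists>a\<in>{m..<m + w}. g (fwd d (2 * a)) \<and> (\<exists>t\<in>{..<m}. g (bwd d (2 * a - 1 - 2 * t))))"
  have dxs: "distinct xs" "set xs \<subseteq> {..<n}" using path unfolding open_path_def by auto
  have key_pos: "a = c \<and> b = d \<or> a = d \<and> b = c"
    if "key (xs ! a) (xs ! b) = key (xs ! c) (xs ! d)" "a < ?L" "b < ?L" "c < ?L" "d < ?L" for a b c d
    using that dxs(1) unfolding key_eq by (auto simp: nth_eq_iff_index_eq)
  have key_keys: "key (xs ! a) (xs ! b) \<in> keys n" if "a < ?L" "b < ?L" "a \<noteq> b" for a b
  proof -
    have "xs ! a < n" "xs ! b < n" "xs ! a \<noteq> xs ! b"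
      using that dxs subsetD[OF dxs(2) nth_mem] by (auto simp: nth_eq_iff_index_eq)
    then show ?thesis unfolding keys_def by blast
  qed
  have fwd_eq: "a = b \<and> d = d'"
    if "fwd d a = fwd d' b" "a + d < ?L" "b + d' < ?L" "0 < d" "0 < d'" for a b d d'
    using key_pos[of a "a + d" b "b + d'"] that unfolding fwd_def by auto
  have bwd_eq: "a = b \<and> d = d'"
    if "bwd d a = bwd d' b" "a + d + (k - 2) < ?L" "b + d' + (k - 2) < ?L" "0 < d" "0 < d'" for a b d d'
    using key_pos[of "a + d + (k - 2)" a "b + d' + (k - 2)" b] that unfolding bwd_def by auto
  have fwd_bwd: "a = b"
    if "fwd d a = bwd d' b" "a + d < ?L" "b + d' + (k - 2) < ?L" "0 < d" "0 < d'" for a b d d'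
    using key_pos[of a "a + d" "b + d' + (k - 2)" b] that unfolding fwd_def bwd_def by auto
  have FG: "F d \<inter> G d' = {}" if "0 < d" "0 < d'" for d d'
    using fwd_bwd that unfolding F_def G_def by fastforce
  have FF: "F d \<inter> F d' = {}" and GG: "G d \<inter> G d' = {}" if "0 < d" "0 < d'" "d \<noteq> d'" for d d'
    using fwd_eq bwd_eq that unfolding F_def G_def by fastforce+
  have inF: "fwd d (2 * a) \<in> F d" if "d \<in> {1..D}" "a \<in> {m..<m + w}" for d a
    using that len unfolding F_def by auto
  have odd_pos: "odd (2 * a - 1 - 2 * t)" if "a \<in> {m..<m + w}" "t < m" for a t
  proof -
    have "2 * a - 1 - 2 * t = 2 * (a - 1 - t) + 1" using that by auto
    then show ?thesis by simp
  qed
  have lenG: "2 * a - 1 - 2 * t + d + (k - 2) < ?L"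
    if "d \<in> {1..D}" "a \<in> {m..<m + w}" "t < m" for d a t
    using that len m by auto
  have inG: "bwd d (2 * a - 1 - 2 * t) \<in> G d" if "d \<in> {1..D}" "a \<in> {m..<m + w}" "t < m" for d a t
    using odd_pos lenG that unfolding G_def by blast
  have depX: "depends_on (X d) (F d \<union> G d)" if d: "d \<in> {1..D}" for d
  proof -
    have "depends_on (X d)
      (\<Union>a\<in>{m..<m + w}. {fwd d (2 * a)} \<union> (\<Union>t\<in>{..<m}. {bwd d (2 * a - 1 - 2 * t)}))"
      unfolding X_def by (intro depends_on_ex depends_on_conj depends_on_coord)
    then show ?thesis
      by (rule depends_on_mono) (use inF inG d in auto)
  qed
  have probX: "(1 - (1 - q) ^ w) * (1 - (1 - q) ^ m) \<le> measure_pmf.prob (flips n q) {g. X d g}"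
    if d: "d \<in> {1..D}" for d
  proof -
    have "(1 - (1 - q) ^ card {m..<m + w}) * (1 - (1 - q) ^ m) \<le>
      measure_pmf.prob (flips n q) {g. \<exists>a\<in>{m..<m + w}. g (fwd d (2 * a)) \<and>
        (\<exists>t\<in>{..<m}. g (bwd d (2 * a - 1 - 2 * t)))}"
      unfolding flips_def
    proof (rule prob_two_stage_ge[where C = "G d", OF finite_keys _ _ _ _ _ _ q])
      show "inj_on (\<lambda>a. fwd d (2 * a)) {m..<m + w}"
        using fwd_eq[of d _ d] d len by (intro inj_onI) fastforce
      show "(\<lambda>a. fwd d (2 * a)) ` {m..<m + w} \<subseteq> keys n"
        using key_keys d len unfolding fwd_def by auto
      show "(\<lambda>a. fwd d (2 * a)) ` {m..<m + w} \<inter> G d = {}"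
      proof -
        have "F d \<inter> G d = {}" using FG d by auto
        then show ?thesis using inF[OF d] by blast
      qed
    next
      fix a assume a: "a \<in> {m..<m + w}"
      have "depends_on (\<lambda>g. \<exists>t\<in>{..<m}. g (bwd d (2 * a - 1 - 2 * t))) (\<Union>t\<in>{..<m}. {bwd d (2 * a - 1 - 2 * t)})"
        by (intro depends_on_ex depends_on_coord)
      then show "depends_on (\<lambda>g. \<exists>t\<in>{..<m}. g (bwd d (2 * a - 1 - 2 * t))) (G d)"
        by (rule depends_on_mono) (use inG d a in auto)
      let ?M = "Pi_pmf (keys n) False (\<lambda>_. bernoulli_pmf q)"
      let ?B = "(\<lambda>t. bwd d (2 * a - 1 - 2 * t)) ` {..<m}"
      have "inj_on (\<lambda>t. bwd d (2 * a - 1 - 2 * t)) {..<m}"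
      proof (rule inj_onI)
        fix t t' assume tt: "t \<in> {..<m}" "t' \<in> {..<m}"
          and eq: "bwd d (2 * a - 1 - 2 * t) = bwd d (2 * a - 1 - 2 * t')"
        have "2 * a - 1 - 2 * t = 2 * a - 1 - 2 * t'"
          using bwd_eq[OF eq] lenG[OF d a] tt d by auto
        then show "t = t'" using tt a by auto
      qed
      then have "card ?B = m" by (simp add: card_image)
      moreover have "?B \<subseteq> keys n"
      proof (rule image_subsetI)
        fix t assume "t \<in> {..<m}"
        then show "bwd d (2 * a - 1 - 2 * t) \<in> keys n"
          unfolding bwd_def using lenG[OF d a, of t] d by (intro key_keys) auto
      qed
      ultimately have "measure_pmf.prob ?M {g. \<forall>e\<in>?B. \<not> g e} = (1 - q) ^ m"
        using prob_all_closed[OF finite_keys _ q, of ?B n] by simp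
      moreover have "{g. \<exists>t\<in>{..<m}. g (bwd d (2 * a - 1 - 2 * t))} = UNIV - {g. \<forall>e\<in>?B. \<not> g e}"
        by auto
      ultimately show "1 - (1 - q) ^ m \<le> measure_pmf.prob ?M {g. \<exists>t\<in>{..<m}. g (bwd d (2 * a - 1 - 2 * t))}"
        using measure_pmf.prob_compl[of "{g. \<forall>e\<in>?B. \<not> g e}" ?M] by simp
    qed simp
    then show ?thesis unfolding X_def by simp
  qed
  have "has_cycle n k (\<lambda>e. f e \<or> g e)" if X: "X d g" and d: "d \<in> {1..D}" for d g
  proof -
    obtain a t where a: "a \<in> {m..<m + w}" and t: "t < m"
      and g: "g (fwd d (2 * a))" "g (bwd d (2 * a - 1 - 2 * t))"
      using X unfolding X_def by auto
    define i where "i = 2 * a - 1 - 2 * t"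
    have i: "i + 2 * t + 1 = 2 * a" using a t unfolding i_def by auto
    have "open_path n xs (\<lambda>e. f e \<or> g e)" using path unfolding open_path_def by auto
    then have "has_cycle n ((2 * a - i + 1) + (i + d + (k - 2) - (2 * a + d) + 1)) (\<lambda>e. f e \<or> g e)"
      using g lenG[OF d a t] d i t m unfolding fwd_def bwd_def i_def[symmetric]
      by (intro has_cycle_two_chords[of n xs]) auto
    moreover have "(2 * a - i + 1) + (i + d + (k - 2) - (2 * a + d) + 1) = k"
      using i t m by linarith
    ultimately show ?thesis by (simp only:)
  qed
  then have "measure_pmf.prob (flips n q) {g. \<not> has_cycle n k (\<lambda>e. f e \<or> g e)} \<le>
      measure_pmf.prob (flips n q) {g. \<forall>d\<in>{1..D}. \<not> X d g}"
    by (intro measure_pmf.finite_measure_mono) auto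
  also have "\<dots> \<le> (1 - (1 - (1 - q) ^ w) * (1 - (1 - q) ^ m)) ^ card {1..D}"
    unfolding flips_def
  proof (rule prob_none_le[OF finite_keys, where B = "\<lambda>d. F d \<union> G d"])
    show "0 \<le> (1 - (1 - q) ^ w) * (1 - (1 - q) ^ m)" using q by (simp add: power_le_one)
    show "(F d \<union> G d) \<inter> (F d' \<union> G d') = {}" if "d \<in> {1..D}" "d' \<in> {1..D}" "d \<noteq> d'" for d d'
      using FF[of d d'] GG[of d d'] FG[of d d'] FG[of d' d] that by auto
  qed (use depX probX in \<open>auto simp: flips_def\<close>)
  finally show ?thesis by simp
qed

text \<open>
  The spare length of the path is \<open>\<tau> * n\<close>, where \<open>\<tau> = \<beta> - \<kappa>\<close>. It leaves room for \<open>w\<close> differences and \<open>w\<close>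
  starting points each, where \<open>w\<close> is about \<open>\<tau> * n / 8\<close>, and for \<open>m\<close> completions, where \<open>m\<close> is a small
  multiple of \<open>k\<close>. Each difference then succeeds with probability at least a constant times \<open>k / n\<close>.
\<close>

lemma prob_no_k_cycle_after_sprinkling_le_exp:
  fixes \<kappa> \<beta> \<sigma> :: real
  assumes "0 < \<kappa>" "\<kappa> < \<beta>" "0 < \<sigma>"
  shows "\<exists>\<rho> K N. 0 < \<rho> \<and> (\<forall>n\<ge>N. \<forall>q f xs k. \<sigma> / real n \<le> q \<longrightarrow> q \<le> 1 \<longrightarrow> open_path n xs f \<longrightarrow>
     \<beta> * real n \<le> real (length xs) \<longrightarrow> K \<le> k \<longrightarrow> real k \<le> \<kappa> * real n \<longrightarrow>
     measure_pmf.prob (flips n q) {g. \<not> has_cycle n k (\<lambda>e. f e \<or> g e)} \<le> exp (- (\<rho> * real k)))"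
proof -
  define \<tau> where "\<tau> = \<beta> - \<kappa>"
  \<comment> \<open>About \<open>a * k\<close> is the number of completions: \<open>1/4\<close> ensures \<open>2 * m < k\<close>, and \<open>\<tau> / 16\<close> keeps them within the spare length.\<close>
  define a where "a = min (1/4) (\<tau> / 16)"
  define c where "c = 1 - exp (- (\<sigma> * \<tau> / 16))"
  \<comment> \<open>Capping \<open>\<sigma>\<close> keeps \<open>\<sigma>' * m / n\<close> in the unit interval, where \<open>1 - exp (- x) \<ge> x / 2\<close>.\<close>
  define \<sigma>' where "\<sigma>' = min \<sigma> 1"
  define \<rho> where "\<rho> = c * \<sigma>' * a * \<tau> / 64"
  have \<tau>: "0 < \<tau>" using assms unfolding \<tau>_def by simp
  have a: "0 < a" "a \<le> 1/4" "a \<le> \<tau> / 16" using \<tau> unfolding a_def by auto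
  have c: "0 < c" "c \<le> 1" unfolding c_def using \<tau> assms by auto
  have \<sigma>': "0 < \<sigma>'" "\<sigma>' \<le> \<sigma>" "\<sigma>' \<le> 1" unfolding \<sigma>'_def using assms by auto
  have "measure_pmf.prob (flips n q) {g. \<not> has_cycle n k (\<lambda>e. f e \<or> g e)} \<le> exp (- (\<rho> * real k))"
    if n: "max 1 (nat \<lceil>16 / \<tau>\<rceil>) \<le> n" and q: "\<sigma> / real n \<le> q" "q \<le> 1" and path: "open_path n xs f"
      and len: "\<beta> * real n \<le> real (length xs)" and k: "max 2 (nat \<lceil>2 / a\<rceil>) \<le> k" "real k \<le> \<kappa> * real n"
    for n q f xs k
  proof -
    define w where "w = nat \<lfloor>\<tau> * real n / 8\<rfloor>"
    define m where "m = nat \<lfloor>a * real k\<rfloor>"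
    have n0: "0 < real n" using n by simp
    have q0: "0 \<le> q" using q(1) assms n0 by (meson divide_nonneg_pos less_imp_le order_trans)
    have "16 / \<tau> \<le> real n" using n by linarith
    then have "16 \<le> \<tau> * real n" using \<tau> by (simp add: field_simps)
    then have w: "\<tau> * real n / 16 \<le> real w" "real w \<le> \<tau> * real n / 8" unfolding w_def by linarith+
    have "2 / a \<le> real k" using k by linarith
    then have ak: "2 \<le> a * real k" using a by (simp add: field_simps)
    then have m: "a * real k / 2 \<le> real m" "real m \<le> a * real k" unfolding m_def by linarith+
    have "length xs \<le> n"
      using path card_mono[of "{..<n}" "set xs"] unfolding open_path_def by (simp add: distinct_card)
    then have "\<beta> * real n \<le> real n" using len by linarith
    moreover have "\<kappa> * real n \<le> \<beta> * real n" using assms by (intro mult_right_mono) auto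
    ultimately have kn: "real k \<le> real n" using k by linarith
    have "a * real k \<le> 1/4 * real k" using a by (intro mult_right_mono) auto
    then have mk: "2 * real m \<le> real k / 2" "real m \<le> real n" using m kn by linarith+
    have "a * real k \<le> \<tau> / 16 * real n" using a kn by (intro mult_mono) auto
    then have "2 * (real m + real w) + real w + real k \<le> \<beta> * real n"
      using m w k \<tau> n0 unfolding \<tau>_def by (simp add: algebra_simps)
    then have "real (2 * (m + w) + w + k) \<le> real (length xs)" using len by simp
    then have fit: "2 * (m + w) + w + k \<le> length xs" by (simp only: of_nat_le_iff)
    have "2 * m < k" using mk k(1) by linarith
    then have *: "measure_pmf.prob (flips n q) {g. \<not> has_cycle n k (\<lambda>e. f e \<or> g e)}
        \<le> (1 - (1 - (1 - q) ^ w) * (1 - (1 - q) ^ m)) ^ w"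
      using prob_no_k_cycle_after_sprinkling[OF path q0 q(2) _ fit] by simp
    have pow: "(1 - q) ^ i \<le> exp (- (t * real i / real n))" if "t \<le> \<sigma>" for i t
    proof -
      have "1 - q \<le> exp (- q)" using exp_ge_add_one_self[of "- q"] by simp
      then have "(1 - q) ^ i \<le> exp (- q) ^ i" using q by (intro power_mono) auto
      also have "\<dots> = exp (- (q * real i))" by (simp flip: exp_of_nat_mult)
      also have "\<dots> \<le> exp (- (t * real i / real n))"
      proof -
        have "t / real n \<le> q" using q(1) that n0 by (meson divide_right_mono less_imp_le order_trans)
        then have "t / real n * real i \<le> q * real i" by (intro mult_right_mono) auto
        then show ?thesis by simp
      qed
      finally show ?thesis .
    qed
    have "\<sigma> * \<tau> / 16 \<le> \<sigma> * real w / real n"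
    proof -
      have "\<sigma> * (\<tau> * real n / 16) \<le> \<sigma> * real w" using w assms by (intro mult_left_mono) auto
      then show ?thesis using n0 by (simp add: field_simps)
    qed
    then have "exp (- (\<sigma> * real w / real n)) \<le> exp (- (\<sigma> * \<tau> / 16))" by simp
    then have r1: "c \<le> 1 - (1 - q) ^ w" using pow[of \<sigma> w] unfolding c_def by linarith
    have r2: "\<sigma>' * a * real k / (4 * real n) \<le> 1 - (1 - q) ^ m"
    proof -
      define x where "x = \<sigma>' * real m / real n"
      have x: "0 \<le> x" "x \<le> 1" unfolding x_def using \<sigma>' mk n0 by (auto simp: divide_le_eq mult_le_one intro: order_trans[OF mult_right_mono])
      have "\<sigma>' * (a * real k / 2) \<le> \<sigma>' * real m" using m \<sigma>' by (intro mult_left_mono) auto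
      then have "\<sigma>' * a * real k / (4 * real n) \<le> x / 2"
        unfolding x_def using n0 by (simp add: field_simps)
      also have "x / 2 \<le> 1 - 1 / (1 + x)" using x by (simp add: field_simps) (simp add: mult_left_le)
      also have "1 - 1 / (1 + x) \<le> 1 - exp (- x)"
        using exp_ge_add_one_self[of x] x by (simp add: exp_minus field_simps)
      also have "\<dots> \<le> 1 - (1 - q) ^ m" using pow[of \<sigma>' m] \<sigma>' unfolding x_def by simp
      finally show ?thesis .
    qed
    let ?r = "c * (\<sigma>' * a * real k / (4 * real n))"
    have r: "?r \<le> (1 - (1 - q) ^ w) * (1 - (1 - q) ^ m)"
      using r1 r2 c \<sigma>' a n0 by (intro mult_mono) auto
    have "(1 - (1 - (1 - q) ^ w) * (1 - (1 - q) ^ m)) ^ w \<le> exp (- ?r) ^ w"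
    proof (rule power_mono)
      show "1 - (1 - (1 - q) ^ w) * (1 - (1 - q) ^ m) \<le> exp (- ?r)"
        using r exp_ge_add_one_self[of "- ?r"] by linarith
      show "0 \<le> 1 - (1 - (1 - q) ^ w) * (1 - (1 - q) ^ m)"
        using q q0 by (simp add: mult_le_one power_le_one)
    qed
    also have "\<dots> = exp (- (?r * real w))" by (simp add: mult.commute flip: exp_of_nat_mult)
    also have "\<dots> \<le> exp (- (\<rho> * real k))"
    proof -
      have "?r * (\<tau> * real n / 16) \<le> ?r * real w"
        using w c \<sigma>' a n0 by (intro mult_left_mono) auto
      moreover have "?r * (\<tau> * real n / 16) = \<rho> * real k"
        unfolding \<rho>_def using n0 by simp
      ultimately show ?thesis by (simp only: exp_le_cancel_iff neg_le_iff_le)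
    qed
    finally show ?thesis using * by simp
  qed
  moreover have "0 < \<rho>" unfolding \<rho>_def using c \<sigma>' a \<tau> by simp
  ultimately show ?thesis by blast
qed

text \<open>
  The geometric sum is the union bound over all lengths \<open>k \<ge> K\<close> in the range.
\<close>

lemma prob_long_cycles_ge:
  fixes \<kappa> \<beta> \<epsilon>1 \<epsilon> :: real
  assumes "0 < \<kappa>" "\<kappa> < \<beta>" "0 < \<epsilon>1" "\<epsilon>1 < \<epsilon>"
  shows "\<exists>\<rho> K0. 0 < \<rho> \<and> (\<forall>K\<ge>K0. \<forall>\<^sub>F n in sequentially.
     measure_pmf.prob (flips n ((1 + \<epsilon>1) / real n)) {f. \<exists>k. \<beta> * real n \<le> real k \<and> has_cycle n k f}
        * (1 - exp (- \<rho>) ^ K / (1 - exp (- \<rho>)))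
     \<le> measure_pmf.prob (flips n ((1 + \<epsilon>) / real n)) {f. \<forall>k. K \<le> k \<and> real k \<le> \<kappa> * real n \<longrightarrow> has_cycle n k f})"
proof -
  obtain \<rho> K0 N where \<rho>: "0 < \<rho>" and "\<forall>n\<ge>N. \<forall>q f xs k. (\<epsilon> - \<epsilon>1) / real n \<le> q \<longrightarrow> q \<le> 1 \<longrightarrow>
     open_path n xs f \<longrightarrow> \<beta> * real n \<le> real (length xs) \<longrightarrow> K0 \<le> k \<longrightarrow> real k \<le> \<kappa> * real n \<longrightarrow>
     measure_pmf.prob (flips n q) {g. \<not> has_cycle n k (\<lambda>e. f e \<or> g e)} \<le> exp (- (\<rho> * real k))"
    using prob_no_k_cycle_after_sprinkling_le_exp[OF assms(1,2), of "\<epsilon> - \<epsilon>1"] assms(4) by auto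
  note fail = this(2)[rule_format]
  have "\<forall>\<^sub>F n in sequentially.
     measure_pmf.prob (flips n ((1 + \<epsilon>1) / real n)) {f. \<exists>k. \<beta> * real n \<le> real k \<and> has_cycle n k f}
        * (1 - exp (- \<rho>) ^ K / (1 - exp (- \<rho>)))
     \<le> measure_pmf.prob (flips n ((1 + \<epsilon>) / real n)) {f. \<forall>k. K \<le> k \<and> real k \<le> \<kappa> * real n \<longrightarrow> has_cycle n k f}"
    if K: "K0 \<le> K" for K
    using eventually_ge_at_top[of "max N (nat \<lceil>1 + \<epsilon>\<rceil>)"]
  proof eventually_elim
    case (elim n)
    define p1 where "p1 = (1 + \<epsilon>1) / real n"
    define p where "p = (1 + \<epsilon>) / real n"
    \<comment> \<open>The parameter of the second round, the solution of \<open>1 - p = (1 - p1) * (1 - q)\<close>.\<close>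
    define q where "q = (p - p1) / (1 - p1)"
    have n: "N \<le> n" "1 + \<epsilon> \<le> real n" using elim by linarith+
    have n0: "0 < real n" using n assms by linarith
    have p: "0 < p1" "p1 < p" "p \<le> 1" unfolding p1_def p_def using n n0 assms by (auto simp: divide_simps)
    have q: "p - p1 \<le> q" "q \<le> 1" "1 - p = (1 - p1) * (1 - q)"
      unfolding q_def using p by (auto simp: field_simps mult_left_le)
    have q': "(\<epsilon> - \<epsilon>1) / real n \<le> q" using q(1) unfolding p_def p1_def by (simp flip: diff_divide_distrib)
    define B where "B = {k. K \<le> k \<and> real k \<le> \<kappa> * real n}"
    have "B \<subseteq> {..nat \<lfloor>\<kappa> * real n\<rfloor>}" unfolding B_def by (auto simp: le_nat_floor)
    then have finB: "finite B" by (rule finite_subset) simp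
    show ?case
      unfolding p1_def[symmetric] p_def[symmetric] flips_def
    proof (rule sprinkling[OF finite_keys, of p1 q p])
      fix f assume "\<exists>k. \<beta> * real n \<le> real k \<and> has_cycle n k f"
      then obtain xs where xs: "open_path n xs f" "\<beta> * real n \<le> real (length xs)"
        using has_cycle_imp_open_path by blast
      let ?M = "Pi_pmf (keys n) False (\<lambda>_. bernoulli_pmf q)"
      let ?T = "{g. \<forall>k. K \<le> k \<and> real k \<le> \<kappa> * real n \<longrightarrow> has_cycle n k (\<lambda>e. f e \<or> g e)}"
      have "measure_pmf.prob ?M (UNIV - ?T) = measure_pmf.prob ?M (\<Union>k\<in>B. {g. \<not> has_cycle n k (\<lambda>e. f e \<or> g e)})"
        unfolding B_def by (intro arg_cong[where f = "measure_pmf.prob ?M"]) auto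
      also have "\<dots> \<le> (\<Sum>k\<in>B. measure_pmf.prob ?M {g. \<not> has_cycle n k (\<lambda>e. f e \<or> g e)})"
        by (intro measure_pmf.finite_measure_subadditive_finite finB) auto
      also have "\<dots> \<le> (\<Sum>k\<in>B. exp (- (\<rho> * real k)))"
        using fail[OF n(1) q' q(2) xs] K by (intro sum_mono) (auto simp: B_def flips_def)
      also have "\<dots> \<le> exp (- \<rho>) ^ K / (1 - exp (- \<rho>))"
        using \<rho> finB by (rule sum_exp_tail_le) (auto simp: B_def)
      finally show "1 - exp (- \<rho>) ^ K / (1 - exp (- \<rho>)) \<le> measure_pmf.prob ?M ?T"
        using measure_pmf.prob_compl[of ?T ?M] by simp
    qed (use p q in auto)
  qed
  then show ?thesis using \<rho> by blast
qed

text \<open>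
  For large \<open>n\<close> the event \<open>E\<close> of the theorem implies \<open>S K\<close>, that all lengths from \<open>l\<close> to \<open>K - 1\<close> occur, and it follows from
  \<open>S K\<close> and \<open>T K\<close>, that all lengths in the range from \<open>K\<close> on occur. The probability of \<open>S K\<close> tends to
  a partial product, and that of \<open>T K\<close> is eventually close to 1.
\<close>

theorem prob_all_cycle_lengths_tendsto:
  fixes \<gamma>0 \<epsilon>0 \<epsilon> \<delta> :: real
  assumes \<gamma>0: "0 < \<gamma>0"
    and long: "\<And>\<epsilon>. 0 < \<epsilon> \<Longrightarrow> \<epsilon> < \<epsilon>0 \<Longrightarrow>
      (\<lambda>n. measure_pmf.prob (flips n ((1 + \<epsilon>) / real n))
        {f. \<exists>k. \<gamma>0 * \<epsilon>\<^sup>2 * real n \<le> real k \<and> has_cycle n k f}) \<longlonglongrightarrow> 1"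
    and \<epsilon>: "0 < \<epsilon>" "\<epsilon> < \<epsilon>0" and l: "3 \<le> l" and \<delta>: "0 < \<delta>" "\<delta> < 1"
  shows "(\<lambda>n. measure_pmf.prob (flips n ((1 + \<epsilon>) / real n))
      {f. \<forall>k. l \<le> k \<and> real k \<le> (1 - \<delta>) * \<gamma>0 * \<epsilon>\<^sup>2 * real n \<longrightarrow> has_cycle n k f})
    \<longlonglongrightarrow> (\<Prod>j. 1 - exp (- ((1 + \<epsilon>) ^ (l + j) / (real s * real (l + j)))))"
proof -
  define e where "e = (\<lambda>k. exp (- ((1 + \<epsilon>) ^ k / (real s * real k))))"
  define \<theta> where "\<theta> = (\<Prod>j. 1 - e (l + j))"
  define \<kappa> where "\<kappa> = (1 - \<delta>) * \<gamma>0 * \<epsilon>\<^sup>2"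
  \<comment> \<open>Chosen such that the cycle of the first round has length at least \<open>(1 - \<delta> / 2) * \<gamma>0 * \<epsilon> ^ 2 * n\<close>,
    which exceeds the range by a positive multiple of \<open>n\<close>.\<close>
  define \<epsilon>1 where "\<epsilon>1 = \<epsilon> * sqrt (1 - \<delta> / 2)"
  define M where "M = (\<lambda>n. measure_pmf (flips n ((1 + \<epsilon>) / real n)))"
  define E where "E = (\<lambda>n. {f. \<forall>k. l \<le> k \<and> real k \<le> \<kappa> * real n \<longrightarrow> has_cycle n k f})"
  define S where "S = (\<lambda>K n. {f. \<forall>k\<in>{l..<K}. has_cycle n k f})"
  define T where "T = (\<lambda>K n. {f. \<forall>k. K \<le> k \<and> real k \<le> \<kappa> * real n \<longrightarrow> has_cycle n k f})"
  define a where "a = (\<lambda>K. \<Prod>k=l..<K. 1 - e k)"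
  have s0: "0 < real s" using s_cases by auto
  have \<kappa>: "0 < \<kappa>" unfolding \<kappa>_def using \<gamma>0 \<epsilon> \<delta> by simp
  have \<epsilon>1: "0 < \<epsilon>1" "\<epsilon>1 < \<epsilon>" unfolding \<epsilon>1_def using \<epsilon> \<delta> by auto
  have \<beta>: "\<gamma>0 * \<epsilon>1\<^sup>2 = (1 - \<delta> / 2) * \<gamma>0 * \<epsilon>\<^sup>2"
    unfolding \<epsilon>1_def using \<delta> by (simp add: power_mult_distrib)
  have "\<kappa> < \<gamma>0 * \<epsilon>1\<^sup>2"
    unfolding \<beta> \<kappa>_def using \<gamma>0 \<epsilon> \<delta> by (intro mult_strict_right_mono) auto
  then obtain \<rho> K0 where \<rho>: "0 < \<rho>" and T: "\<And>K. K0 \<le> K \<Longrightarrow> \<forall>\<^sub>F n in sequentially.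
     measure_pmf.prob (flips n ((1 + \<epsilon>1) / real n)) {f. \<exists>k. \<gamma>0 * \<epsilon>1\<^sup>2 * real n \<le> real k \<and> has_cycle n k f}
        * (1 - exp (- \<rho>) ^ K / (1 - exp (- \<rho>))) \<le> Sigma_Algebra.measure (M n) (T K n)"
    using prob_long_cycles_ge[OF \<kappa> _ \<epsilon>1] unfolding M_def T_def by blast
  define t where "t = (\<lambda>K. exp (- \<rho>) ^ K / (1 - exp (- \<rho>)))"
  have longe: "(\<lambda>n. measure_pmf.prob (flips n ((1 + \<epsilon>1) / real n))
        {f. \<exists>k. \<gamma>0 * \<epsilon>1\<^sup>2 * real n \<le> real k \<and> has_cycle n k f}) \<longlonglongrightarrow> 1"
    using long[of \<epsilon>1] \<epsilon>1 \<epsilon> by simp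
  have t: "t \<longlonglongrightarrow> 0"
  proof -
    have "(\<lambda>K. exp (- \<rho>) ^ K / (1 - exp (- \<rho>))) \<longlonglongrightarrow> 0 / (1 - exp (- \<rho>))"
      using \<rho> by (intro tendsto_intros LIMSEQ_realpow_zero) auto
    then show ?thesis unfolding t_def by simp
  qed
  have a: "a \<longlonglongrightarrow> \<theta>"
    unfolding a_def \<theta>_def
  proof (rule partial_products_tendsto_prodinf)
    show "summable e" unfolding e_def using \<epsilon> s0 by (intro summable_exp_neg_power) auto
    show "0 \<le> e k" for k unfolding e_def by simp
  qed
  have S: "(\<lambda>n. Sigma_Algebra.measure (M n) (S K n)) \<longlonglongrightarrow> a K" for K
  proof -
    have "{l..<K} \<subseteq> {3..}" using l by auto
    then show ?thesis
      using prob_cycle_lengths_tendsto[of "{l..<K}" "1 + \<epsilon>" "{}"] \<epsilon>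
      unfolding M_def S_def a_def e_def by simp
  qed
  have "(\<lambda>n. Sigma_Algebra.measure (M n) (E n)) \<longlonglongrightarrow> \<theta>"
  proof (rule tendstoI)
    fix \<eta> :: real assume \<eta>: "0 < \<eta>"
    have "\<forall>\<^sub>F K in sequentially. dist (a K) \<theta> < \<eta> / 4 \<and> t K < \<eta> / 4 \<and> max K0 l \<le> K"
      using tendstoD[OF a, of "\<eta> / 4"] order_tendstoD(2)[OF t, of "\<eta> / 4"] \<eta>
        eventually_ge_at_top[of "max K0 l"]
      by (intro eventually_conj) auto
    then obtain K where K: "dist (a K) \<theta> < \<eta> / 4" "t K < \<eta> / 4" "K0 \<le> K" "l \<le> K"
      by (auto dest: eventually_happens)
    have "(\<lambda>n. measure_pmf.prob (flips n ((1 + \<epsilon>1) / real n))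
        {f. \<exists>k. \<gamma>0 * \<epsilon>1\<^sup>2 * real n \<le> real k \<and> has_cycle n k f} * (1 - t K)) \<longlonglongrightarrow> 1 * (1 - t K)"
      by (intro tendsto_intros longe)
    then have "\<forall>\<^sub>F n in sequentially. 1 - \<eta> / 4 < measure_pmf.prob (flips n ((1 + \<epsilon>1) / real n))
        {f. \<exists>k. \<gamma>0 * \<epsilon>1\<^sup>2 * real n \<le> real k \<and> has_cycle n k f} * (1 - t K)"
      by (rule order_tendstoD) (use K in simp)
    moreover have "\<forall>\<^sub>F n in sequentially. real K / \<kappa> \<le> real n"
      using eventually_ge_at_top[of "nat \<lceil>real K / \<kappa>\<rceil>"] by eventually_elim linarith
    moreover have "\<forall>\<^sub>F n in sequentially. dist (Sigma_Algebra.measure (M n) (S K n)) (a K) < \<eta> / 4"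
      using tendstoD[OF S, of "\<eta> / 4" K] \<eta> by simp
    ultimately show "\<forall>\<^sub>F n in sequentially. dist (Sigma_Algebra.measure (M n) (E n)) \<theta> < \<eta>"
      using T[OF K(3)]
    proof eventually_elim
      case (elim n)
      interpret prob_space "M n" unfolding M_def by (rule measure_pmf.prob_space_axioms)
      have [simp]: "sets (M n) = UNIV" "space (M n) = UNIV" unfolding M_def by auto
      have "real K \<le> \<kappa> * real n" using elim(2) \<kappa> by (simp add: field_simps)
      then have "E n \<subseteq> S K n" unfolding E_def S_def by auto
      then have up: "prob (E n) \<le> prob (S K n)" by (intro finite_measure_mono) auto
      have "S K n \<subseteq> E n \<union> (UNIV - T K n)" unfolding E_def S_def T_def by (auto simp: not_le)
      then have "prob (S K n) \<le> prob (E n \<union> (UNIV - T K n))" by (intro finite_measure_mono) auto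
      also have "\<dots> \<le> prob (E n) + prob (UNIV - T K n)" by (intro measure_Un_le) auto
      also have "prob (UNIV - T K n) = 1 - prob (T K n)" using prob_compl[of "T K n"] by simp
      finally have "prob (S K n) - (1 - prob (T K n)) \<le> prob (E n)" by simp
      moreover have "1 - \<eta> / 4 \<le> prob (T K n)" using elim(1,4) unfolding t_def by linarith
      ultimately show ?case using up elim(3) K(1) by (simp add: dist_real_def abs_if split: if_splits)
    qed
  qed
  then show ?thesis unfolding M_def E_def \<kappa>_def \<theta>_def e_def .
qed

end

section \<open>Cycles of the random graphs\<close>

text \<open>
  A cycle as a closed list of arcs corresponds to the list of the heads of its arcs, which is
  \<open>rotate1\<close> of the list of the tails.
\<close>

lemma with_proj_cycle_iff:
  fixes G :: "'a pair_pre_digraph"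
  assumes arcs: "parcs G \<subseteq> pverts G \<times> pverts G" and k: "0 < k"
  shows "(\<exists>p. pre_digraph.cycle (with_proj G) p \<and> length p = k) \<longleftrightarrow>
    (\<exists>xs. length xs = k \<and> distinct xs \<and> (\<forall>i<k. (xs ! i, xs ! (Suc i mod k)) \<in> parcs G))"
proof
  have verts: "length (pawalk_verts u p) = Suc (length p)" for u :: 'a and p
    by (induction p arbitrary: u) auto
  have cas_nth: "pcas u p v \<longleftrightarrow> (p = [] \<longrightarrow> u = v) \<and> (p \<noteq> [] \<longrightarrow> fst (p ! 0) = u \<and> snd (last p) = v) \<and>
      (\<forall>i. Suc i < length p \<longrightarrow> snd (p ! i) = fst (p ! Suc i))" for u v :: 'a and p
  proof (induction p arbitrary: u)
    case (Cons e p)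
    have all_nat: "(\<forall>i. P i) \<longleftrightarrow> P 0 \<and> (\<forall>i. P (Suc i))" for P :: "nat \<Rightarrow> bool"
      by (metis nat.exhaust)
    have "(\<forall>i. Suc i < length (e # p) \<longrightarrow> snd ((e # p) ! i) = fst ((e # p) ! Suc i)) \<longleftrightarrow>
        (p \<noteq> [] \<longrightarrow> snd e = fst (p ! 0)) \<and> (\<forall>i. Suc i < length p \<longrightarrow> snd (p ! i) = fst (p ! Suc i))"
      by (subst all_nat) simp
    then show ?case
      unfolding pcas.simps Cons.IH by auto
  qed simp
  have tl_verts: "tl (pawalk_verts u p) = map snd p" if "pcas u p v" for u v :: 'a and p
    using that
  proof (induction p arbitrary: u)
    case (Cons e p)
    then show ?case by (cases p) auto
  qed simp
  {
    assume "\<exists>p. pre_digraph.cycle (with_proj G) p \<and> length p = k"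
    then obtain p u where p: "length p = k" "set p \<subseteq> parcs G" "pcas u p u" "distinct (map snd p)"
      unfolding pre_digraph.cycle_def pre_digraph.awalk_def
      by (auto simp: cas_with_proj_eq awalk_verts_with_proj_eq tl_verts)
    have "(map snd p ! i, map snd p ! (Suc i mod k)) \<in> parcs G" if i: "i < k" for i
    proof -
      let ?j = "Suc i mod k"
      have j: "?j < k" using i by simp
      have "snd (p ! i) = fst (p ! ?j)"
      proof (cases "Suc i = k")
        case True
        have "p \<noteq> []" using p(1) k by auto
        moreover have "i = length p - 1" using p(1) True by linarith
        ultimately have "p ! i = last p" by (metis last_conv_nth)
        then show ?thesis using p(3) True \<open>p \<noteq> []\<close> unfolding cas_nth by simp
      next
        case False
        then show ?thesis using p(1,3) i unfolding cas_nth by simp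
      qed
      then have "(map snd p ! i, map snd p ! ?j) = p ! ?j"
        using i j p(1) by simp
      then show ?thesis using p(1,2) j nth_mem[of ?j p] by auto
    qed
    then show "\<exists>xs. length xs = k \<and> distinct xs \<and> (\<forall>i<k. (xs ! i, xs ! (Suc i mod k)) \<in> parcs G)"
      using p by (intro exI[of _ "map snd p"]) auto
  }
  {
    assume "\<exists>xs. length xs = k \<and> distinct xs \<and> (\<forall>i<k. (xs ! i, xs ! (Suc i mod k)) \<in> parcs G)"
    then obtain xs where xs: "length xs = k" "distinct xs"
      and a: "\<And>i. i < k \<Longrightarrow> (xs ! i, xs ! (Suc i mod k)) \<in> parcs G" by auto
    define p where "p = map (\<lambda>i. (xs ! i, xs ! (Suc i mod k))) [0..<k]"
    have "p \<noteq> []" using k unfolding p_def by simp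
    have cas: "pcas (xs ! 0) p (xs ! 0)"
      unfolding cas_nth p_def using k by (auto simp: last_map last_upt)
    have "map snd p = rotate1 xs"
      by (rule nth_equalityI) (auto simp: p_def nth_rotate1 xs)
    then have "distinct (map snd p)" using xs by simp
    moreover have "set p \<subseteq> parcs G" unfolding p_def using a by auto
    moreover have "xs ! 0 \<in> pverts G" using a[OF k] arcs by auto
    ultimately have "pre_digraph.cycle (with_proj G) p"
      unfolding pre_digraph.cycle_def pre_digraph.awalk_def
      using cas \<open>p \<noteq> []\<close> by (auto simp: cas_with_proj_eq awalk_verts_with_proj_eq tl_verts)
    moreover have "length p = k" unfolding p_def by simp
    ultimately show "\<exists>p. pre_digraph.cycle (with_proj G) p \<and> length p = k" by blast
  }
qed

context cycle_keys begin

definition graph :: "nat \<Rightarrow> ('k \<Rightarrow> bool) \<Rightarrow> nat pair_pre_digraph" where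
  "graph n f = \<lparr>pverts = {..<n}, parcs = {(u, v). u < n \<and> v < n \<and> u \<noteq> v \<and> f (key u v)}\<rparr>"

lemma cycle_in_graph_iff:
  assumes k: "2 \<le> k"
  shows "(\<exists>p. pre_digraph.cycle (with_proj (graph n f)) p \<and> length p = k) \<longleftrightarrow> has_cycle n k f"
proof -
  have "(\<exists>p. pre_digraph.cycle (with_proj (graph n f)) p \<and> length p = k) \<longleftrightarrow>
      (\<exists>xs. length xs = k \<and> distinct xs \<and> (\<forall>i<k. (xs ! i, xs ! (Suc i mod k)) \<in> parcs (graph n f)))"
    by (rule with_proj_cycle_iff) (use k in \<open>auto simp: graph_def\<close>)
  also have "\<dots> \<longleftrightarrow> has_cycle n k f"
  proof
    assume "\<exists>xs. length xs = k \<and> distinct xs \<and> (\<forall>i<k. (xs ! i, xs ! (Suc i mod k)) \<in> parcs (graph n f))"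
    then obtain xs where xs: "length xs = k" "distinct xs"
      "\<And>i. i < k \<Longrightarrow> (xs ! i, xs ! (Suc i mod k)) \<in> parcs (graph n f)" by auto
    then show "has_cycle n k f"
      unfolding has_cycle_def vertex_lists_def cyc_keys_def graph_def
      by (intro bexI[of _ xs]) (auto simp: in_set_conv_nth)
  next
    assume "has_cycle n k f"
    then obtain xs where xs: "length xs = k" "distinct xs" "set xs \<subseteq> {..<n}" and f: "\<forall>e\<in>cyc_keys xs. f e"
      unfolding has_cycle_def vertex_lists_def by auto
    have "(xs ! i, xs ! (Suc i mod k)) \<in> parcs (graph n f)" if i: "i < k" for i
    proof -
      have j: "Suc i mod k < k" using i by (rule Suc_mod_less)
      have "i \<noteq> Suc i mod k" using i k by (cases "Suc i = k") auto
      then have "xs ! i \<noteq> xs ! (Suc i mod k)" using i j xs by (simp add: nth_eq_iff_index_eq)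
      moreover have "xs ! i < n" "xs ! (Suc i mod k) < n" using i j xs nth_mem by blast+
      moreover have "f (key (xs ! i) (xs ! (Suc i mod k)))" using f i xs unfolding cyc_keys_def by auto
      ultimately show ?thesis unfolding graph_def by simp
    qed
    then show "\<exists>xs. length xs = k \<and> distinct xs \<and> (\<forall>i<k. (xs ! i, xs ! (Suc i mod k)) \<in> parcs (graph n f))"
      using xs by auto
  qed
  finally show ?thesis .
qed

lemma has_cycle_le: "has_cycle n k f \<Longrightarrow> k \<le> n"
  using card_mono[of "{..<n}"] unfolding has_cycle_def vertex_lists_def by (fastforce simp flip: distinct_card)

text \<open>
  The set \<open>Ls G\<close> stands for the cycle lengths of a graph or of a digraph. Lengths below 3 can matter
  only for the maximum, and not once \<open>\<gamma>0 * \<epsilon> ^ 2 * n \<ge> 3\<close>.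
\<close>

theorem graph_cycle_lengths_tendsto:
  fixes Ls :: "nat pair_pre_digraph \<Rightarrow> nat set" and \<gamma>0 \<epsilon>0 \<epsilon> \<delta> :: real
  assumes Ls: "\<And>n k f. 3 \<le> k \<Longrightarrow> k \<in> Ls (graph n f) \<longleftrightarrow> has_cycle n k f"
    and \<gamma>0: "0 < \<gamma>0"
    and long: "\<And>\<epsilon>. 0 < \<epsilon> \<Longrightarrow> \<epsilon> < \<epsilon>0 \<Longrightarrow>
      (\<lambda>n. measure_pmf.prob (map_pmf (graph n) (flips n ((1 + \<epsilon>) / real n)))
        {G. \<gamma>0 * \<epsilon>\<^sup>2 * real n \<le> real (Max (insert 0 (Ls G)))}) \<longlonglongrightarrow> 1"
    and \<epsilon>: "0 < \<epsilon>" "\<epsilon> < \<epsilon>0" and l: "3 \<le> l" and \<delta>: "0 < \<delta>" "\<delta> < 1"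
  shows "(\<lambda>n. measure_pmf.prob (map_pmf (graph n) (flips n ((1 + \<epsilon>) / real n)))
      {G. {k. l \<le> k \<and> real k \<le> (1 - \<delta>) * \<gamma>0 * \<epsilon>\<^sup>2 * real n} \<subseteq> Ls G})
    \<longlonglongrightarrow> (\<Prod>j. 1 - exp (- ((1 + \<epsilon>) ^ (l + j) / (real s * real (l + j)))))"
proof -
  have fin: "finite (Ls (graph n f))" for n f
  proof (rule finite_subset)
    show "Ls (graph n f) \<subseteq> {..max 3 n}"
      using Ls has_cycle_le by (auto simp: subset_iff) (metis le_max_iff_disj nat_le_linear)
  qed simp
  have max: "\<exists>k. x \<le> real k \<and> has_cycle n k f"
    if "3 \<le> x" "x \<le> real (Max (insert 0 (Ls (graph n f))))" for x n f
  proof -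
    let ?m = "Max (insert 0 (Ls (graph n f)))"
    have "?m \<in> insert 0 (Ls (graph n f))" using fin by (intro Max_in) auto
    moreover have "3 \<le> ?m" using that by linarith
    ultimately have "has_cycle n ?m f" using Ls by auto
    then show ?thesis using that by auto
  qed
  have "(\<lambda>n. measure_pmf.prob (flips n ((1 + \<epsilon>) / real n))
      {f. \<forall>k. l \<le> k \<and> real k \<le> (1 - \<delta>) * \<gamma>0 * \<epsilon>\<^sup>2 * real n \<longrightarrow> has_cycle n k f})
    \<longlonglongrightarrow> (\<Prod>j. 1 - exp (- ((1 + \<epsilon>) ^ (l + j) / (real s * real (l + j)))))"
  proof (rule prob_all_cycle_lengths_tendsto[OF \<gamma>0 _ \<epsilon> l \<delta>])
    fix \<epsilon> :: real assume \<epsilon>: "0 < \<epsilon>" "\<epsilon> < \<epsilon>0"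
    define P where "P = (\<lambda>n. measure_pmf.prob (flips n ((1 + \<epsilon>) / real n))
      {f. \<exists>k. \<gamma>0 * \<epsilon>\<^sup>2 * real n \<le> real k \<and> has_cycle n k f})"
    define Q where "Q = (\<lambda>n. measure_pmf.prob (map_pmf (graph n) (flips n ((1 + \<epsilon>) / real n)))
        {G. \<gamma>0 * \<epsilon>\<^sup>2 * real n \<le> real (Max (insert 0 (Ls G)))})"
    have pos: "0 < \<gamma>0 * \<epsilon>\<^sup>2" using \<gamma>0 \<epsilon> by simp
    have "\<forall>\<^sub>F n in sequentially. Q n \<le> P n"
      using eventually_ge_at_top[of "nat \<lceil>3 / (\<gamma>0 * \<epsilon>\<^sup>2)\<rceil>"]
    proof eventually_elim
      case (elim n)
      then have "3 / (\<gamma>0 * \<epsilon>\<^sup>2) \<le> real n" by linarith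
      then have "3 \<le> \<gamma>0 * \<epsilon>\<^sup>2 * real n" using pos by (simp add: field_simps)
      then show ?case
        unfolding P_def Q_def using max by (auto intro!: measure_pmf.finite_measure_mono)
    qed
    moreover have "Q \<longlonglongrightarrow> 1" unfolding Q_def using long \<epsilon> by simp
    moreover have "\<forall>\<^sub>F n in sequentially. P n \<le> 1" unfolding P_def by simp
    ultimately show "P \<longlonglongrightarrow> 1"
      using tendsto_sandwich[of Q P sequentially "\<lambda>_. 1" 1] by simp
  qed
  moreover have "{f. \<forall>k. l \<le> k \<and> real k \<le> x \<longrightarrow> has_cycle n k f} =
      graph n -` {G. {k. l \<le> k \<and> real k \<le> x} \<subseteq> Ls G}" for x n
    using Ls l by auto
  ultimately show ?thesis by simp
qed

end

interpretation undirected: cycle_keys "\<lambda>u v :: nat. {u, v}" 2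
  by unfold_locales (auto simp: doubleton_eq_iff)

interpretation directed: cycle_keys "Pair :: nat \<Rightarrow> nat \<Rightarrow> nat \<times> nat" 1
  by unfold_locales auto

lemma gnp_eq: "gnp n p = map_pmf (undirected.graph n) (undirected.flips n p)"
  unfolding gnp_def undirected.graph_def[abs_def] undirected.flips_def undirected.keys_def ..

lemma dnp_eq: "dnp n p = map_pmf (directed.graph n) (directed.flips n p)"
proof -
  have "directed.keys n = {(u, v). u < n \<and> v < n \<and> u \<noteq> v}" unfolding directed.keys_def by auto
  then show ?thesis unfolding dnp_def directed.graph_def[abs_def] directed.flips_def by simp
qed

lemma cycle_lengths_graph: "3 \<le> k \<Longrightarrow> k \<in> cycle_lengths (undirected.graph n f) \<longleftrightarrow> undirected.has_cycle n k f"
  using undirected.cycle_in_graph_iff[of k n f] unfolding cycle_lengths_def by auto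

lemma dicycle_lengths_graph: "3 \<le> k \<Longrightarrow> k \<in> dicycle_lengths (directed.graph n f) \<longleftrightarrow> directed.has_cycle n k f"
  using directed.cycle_in_graph_iff[of k n f] unfolding dicycle_lengths_def by auto

theorem theorem3p7:
  fixes \<gamma>0 \<epsilon>0 :: real
  assumes "\<gamma>0 > 0" and "\<epsilon>0 > 0"
  shows
    "((\<forall>\<epsilon>. 0 < \<epsilon> \<and> \<epsilon> < \<epsilon>0 \<longrightarrow>
         (\<lambda>n::nat. measure_pmf.prob (gnp n ((1 + \<epsilon>) / real n))
            {G. real (longest_cycle G) \<ge> \<gamma>0 * \<epsilon>\<^sup>2 * real n}) \<longlonglongrightarrow> 1)
      \<longrightarrow>
      (\<forall>\<epsilon> (l::nat) \<delta>. 0 < \<epsilon> \<and> \<epsilon> < \<epsilon>0 \<and> 3 \<le> l \<and> 0 < \<delta> \<and> \<delta> < 1 \<longrightarrow>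
         (\<lambda>n::nat. measure_pmf.prob (gnp n ((1 + \<epsilon>) / real n))
            {G. {k::nat. l \<le> k \<and> real k \<le> (1 - \<delta>) * \<gamma>0 * \<epsilon>\<^sup>2 * real n} \<subseteq> cycle_lengths G})
         \<longlonglongrightarrow> theta (1 + \<epsilon>) l))
     \<and>
     ((\<forall>\<epsilon>. 0 < \<epsilon> \<and> \<epsilon> < \<epsilon>0 \<longrightarrow>
         (\<lambda>n::nat. measure_pmf.prob (dnp n ((1 + \<epsilon>) / real n))
            {G. real (longest_dicycle G) \<ge> \<gamma>0 * \<epsilon>\<^sup>2 * real n}) \<longlonglongrightarrow> 1)
      \<longrightarrow>
      (\<forall>\<epsilon> (l::nat) \<delta>. 0 < \<epsilon> \<and> \<epsilon> < \<epsilon>0 \<and> 3 \<le> l \<and> 0 < \<delta> \<and> \<delta> < 1 \<longrightarrow>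
         (\<lambda>n::nat. measure_pmf.prob (dnp n ((1 + \<epsilon>) / real n))
            {G. {k::nat. l \<le> k \<and> real k \<le> (1 - \<delta>) * \<gamma>0 * \<epsilon>\<^sup>2 * real n} \<subseteq> dicycle_lengths G})
         \<longlonglongrightarrow> theta' (1 + \<epsilon>) l))"
proof (intro conjI impI allI; elim conjE)
  fix \<epsilon> \<delta> :: real and l :: nat
  assume "\<forall>\<epsilon>. 0 < \<epsilon> \<and> \<epsilon> < \<epsilon>0 \<longrightarrow> (\<lambda>n::nat. measure_pmf.prob (gnp n ((1 + \<epsilon>) / real n))
            {G. real (longest_cycle G) \<ge> \<gamma>0 * \<epsilon>\<^sup>2 * real n}) \<longlonglongrightarrow> 1"
    and *: "0 < \<epsilon>" "\<epsilon> < \<epsilon>0" "3 \<le> l" "0 < \<delta>" "\<delta> < 1"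
  then show "(\<lambda>n::nat. measure_pmf.prob (gnp n ((1 + \<epsilon>) / real n))
            {G. {k::nat. l \<le> k \<and> real k \<le> (1 - \<delta>) * \<gamma>0 * \<epsilon>\<^sup>2 * real n} \<subseteq> cycle_lengths G})
         \<longlonglongrightarrow> theta (1 + \<epsilon>) l"
    using undirected.graph_cycle_lengths_tendsto[OF cycle_lengths_graph assms(1) _ *]
    unfolding gnp_eq longest_cycle_def theta_def by simp
next
  fix \<epsilon> \<delta> :: real and l :: nat
  assume "\<forall>\<epsilon>. 0 < \<epsilon> \<and> \<epsilon> < \<epsilon>0 \<longrightarrow> (\<lambda>n::nat. measure_pmf.prob (dnp n ((1 + \<epsilon>) / real n))
            {G. real (longest_dicycle G) \<ge> \<gamma>0 * \<epsilon>\<^sup>2 * real n}) \<longlonglongrightarrow> 1"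
    and *: "0 < \<epsilon>" "\<epsilon> < \<epsilon>0" "3 \<le> l" "0 < \<delta>" "\<delta> < 1"
  then show "(\<lambda>n::nat. measure_pmf.prob (dnp n ((1 + \<epsilon>) / real n))
            {G. {k::nat. l \<le> k \<and> real k \<le> (1 - \<delta>) * \<gamma>0 * \<epsilon>\<^sup>2 * real n} \<subseteq> dicycle_lengths G})
         \<longlonglongrightarrow> theta' (1 + \<epsilon>) l"
    using directed.graph_cycle_lengths_tendsto[OF dicycle_lengths_graph assms(1) _ *]
    unfolding dnp_eq longest_dicycle_def theta'_def by simp
qed

end
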